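(* Let $\Gamma$ be a finitely generated, infinite amenable group and let $\mathcal G$ be the Cayley graph of $\Gamma$ with respect to a finite symmetric generating set. There exist an invariant action of $\Gamma$ on a space with measured walls $(X,\mathcal W,\mathcal B,\mu)$ and a point $x_0\in X$ such that for every $\alpha<1$ there is $p\in(0,1)$ for which the $\Gamma$-invariant bond percolation $\mathbb P$ on $\mathcal G$ given by the Poisson wall construction with parameters $(X,\mathcal W,\mathcal B,\mu)$, $x_0$, $p$ satisfies $\mathbb E[\deg_\omega(o)]>\alpha\deg(o)$ and has no infinite clusters almost surely.
   Context: Right Cayley graph: vertex set $\Gamma$, edge set $E=\{[g,gs]: g\in\Gamma, s\in S\}$ with $S$ a finite symmetric generating set; $o$ is the identity, $\deg(o)$ its degree. $\Gamma$ acts by left multiplication. A $\Gamma$-invariant bond percolation is a probability measure $\mathbb P$ (expectation $\mathbb E$) on subsets $\omega\subset E$ invariant under $\Gamma$; clusters are connected components of $(\Gamma,\omega)$; $\deg_\omega(o)$ is the degree of $o$ in $\omega$. A wall on a set $X$ is a partition of $X$ into two classes; it separates $x,y\in X$ if they lie in different classes. A space with measured walls is a 4-tuple $(X,\mathcal W,\mathcal B,\mu)$ with $\mathcal W$ a set of walls on $X$, $\mathcal B$ a $\sigma$-algebra on $\mathcal W$, $\mu$ a measure on $\mathcal B$, such that for all distinct $x,y\in X$ the set $\mathcal W(x,y)$ of walls in $\mathcal W$ separating $x$ and $y$ is in $\mathcal B$ and $w(x,y):=\mu(\mathcal W(x,y))<\infty$. $\Gamma$ has an invariant action on it if $\Gamma$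 acts on $X$ and the maps $\{B,B^c\}\mapsto\{gB,gB^c\}$ define a $\mathcal B$-measurable action of $\Gamma$ on $\mathcal W$ preserving $\mu$. Poisson wall construction: given an invariant action of $\Gamma$ on a space with measured walls, $x_0\in X$ and $p\in(0,1)$, let $\mathcal W_0=\bigcup_{g,h\in\Gamma}\mathcal W(gx_0,hx_0)$ (a $\Gamma$-invariant set on which $\mu$ is $\sigma$-finite) and let $\eta_p$ be a Poisson point process on $\mathcal W_0$ with intensity measure $(1-p)\mu|_{\mathcal W_0}$. Let $\omega$ be the random set of edges $[g,h]\in E$ with $\eta_p(\mathcal W(gx_0,hx_0))=0$. The law of $\omega$ is a $\Gamma$-invariant bond percolation on $\mathcal G$. *)

theory Defs
  imports "HOL-Probability.Probability" "HOL-Algebra.Group_Action" "HOL-Algebra.Generated_Groups"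
begin

section \<open>Amenable groups and Cayley graphs\<close>

text \<open>Amenability of a discrete group in the sense of von Neumann: there is a finitely additive,
  left-invariant probability measure defined on all subsets of the group.\<close>

definition amenable :: "('a, 'b) monoid_scheme \<Rightarrow> bool" where
  "amenable G \<longleftrightarrow> (\<exists>m :: 'a set \<Rightarrow> real.
     (\<forall>A. A \<subseteq> carrier G \<longrightarrow> 0 \<le> m A) \<and>
     m (carrier G) = 1 \<and>
     (\<forall>A B. A \<subseteq> carrier G \<longrightarrow> B \<subseteq> carrier G \<longrightarrow> A \<inter> B = {} \<longrightarrow> m (A \<union> B) = m A + m B) \<and>
     (\<forall>g\<in>carrier G. \<forall>A. A \<subseteq> carrier G \<longrightarrow> m (g <#\<^bsub>G\<^esub> A) = m A))"

definition symmetric_generating_set :: "('a, 'b) monoid_scheme \<Rightarrow> 'a set \<Rightarrow> bool" where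
  "symmetric_generating_set G S \<longleftrightarrow>
     S \<subseteq> carrier G \<and> (\<forall>s\<in>S. inv\<^bsub>G\<^esub> s \<in> S) \<and> generate G S = carrier G"

text \<open>Edges of the right Cayley graph are unordered pairs \<open>{g, g s}\<close>. The identity is not
  excluded from \<open>S\<close>; if it belongs to \<open>S\<close>, there is a loop \<open>{g}\<close> at every vertex, which is
  counted once in the degree.\<close>

definition cayley_edges :: "('a, 'b) monoid_scheme \<Rightarrow> 'a set \<Rightarrow> 'a set set" where
  "cayley_edges G S = {{g, g \<otimes>\<^bsub>G\<^esub> s} | g s. g \<in> carrier G \<and> s \<in> S}"

definition degree_in :: "'a set set \<Rightarrow> 'a \<Rightarrow> nat" where
  "degree_in \<omega> v = card {e \<in> \<omega>. v \<in> e}"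

definition cluster :: "'a set set \<Rightarrow> 'a \<Rightarrow> 'a set" where
  "cluster \<omega> v = {w. (v, w) \<in> {(x, y). {x, y} \<in> \<omega>}\<^sup>*}"


section \<open>Invariant bond percolation\<close>

text \<open>The measurable space of all subsets of \<open>E\<close>, with the product \<open>\<sigma>\<close>-algebra of \<open>{0,1}\<^sup>E\<close>.\<close>

definition edge_configs :: "'a set set \<Rightarrow> 'a set set measure" where
  "edge_configs E = sigma (Pow E) ((\<lambda>e. {\<omega> \<in> Pow E. e \<in> \<omega>}) ` E)"

definition invariant_percolation ::
    "('a, 'b) monoid_scheme \<Rightarrow> 'a set set \<Rightarrow> 'a set set measure \<Rightarrow> bool" where
  "invariant_percolation G E P \<longleftrightarrow>
     prob_space P \<and> sets P = sets (edge_configs E) \<and>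
     (\<forall>g\<in>carrier G. distr P (edge_configs E) (\<lambda>\<omega>. (\<lambda>e. g <#\<^bsub>G\<^esub> e) ` \<omega>) = P)"


section \<open>Spaces with measured walls\<close>

definition wall :: "'x set \<Rightarrow> 'x set set \<Rightarrow> bool" where
  "wall X W \<longleftrightarrow> partition_on X W \<and> card W = 2"

definition separates :: "'x set set \<Rightarrow> 'x \<Rightarrow> 'x \<Rightarrow> bool" where
  "separates W x y \<longleftrightarrow> (\<exists>A\<in>W. \<exists>B\<in>W. A \<noteq> B \<and> x \<in> A \<and> y \<in> B)"

text \<open>The triple \<open>(\<W>, \<B>, \<mu>)\<close> is the single object \<open>\<mu>\<close>, with \<open>\<W> = space \<mu>\<close> and
  \<open>\<B> = sets \<mu>\<close>.\<close>

definition walls_between :: "'x set set measure \<Rightarrow> 'x \<Rightarrow> 'x \<Rightarrow> 'x set set set" where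
  "walls_between \<mu> x y = {W \<in> space \<mu>. separates W x y}"

definition measured_walls :: "'x set \<Rightarrow> 'x set set measure \<Rightarrow> bool" where
  "measured_walls X \<mu> \<longleftrightarrow>
     (\<forall>W\<in>space \<mu>. wall X W) \<and>
     (\<forall>x\<in>X. \<forall>y\<in>X. x \<noteq> y \<longrightarrow>
        walls_between \<mu> x y \<in> sets \<mu> \<and> emeasure \<mu> (walls_between \<mu> x y) < \<infinity>)"

definition invariant_wall_action ::
    "('a, 'b) monoid_scheme \<Rightarrow> 'x set \<Rightarrow> ('a \<Rightarrow> 'x \<Rightarrow> 'x) \<Rightarrow> 'x set set measure \<Rightarrow> bool" where
  "invariant_wall_action G X \<phi> \<mu> \<longleftrightarrow>
     group_action G X \<phi> \<and> measured_walls X \<mu> \<and>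
     (\<forall>g\<in>carrier G. (\<lambda>W. (\<lambda>B. \<phi> g ` B) ` W) \<in> measurable \<mu> \<mu> \<and>
                    distr \<mu> \<mu> (\<lambda>W. (\<lambda>B. \<phi> g ` B) ` W) = \<mu>)"


section \<open>The Poisson wall construction\<close>

text \<open>\<open>\<eta>\<close> is a Poisson point process with intensity measure \<open>\<Lambda>\<close>, defined on the probability space
  \<open>M\<close>: a random integer-valued measure whose value on \<open>A\<close> is Poisson distributed with parameter
  \<open>\<Lambda> A\<close> (almost surely infinite if \<open>\<Lambda> A = \<infinity>\<close>) and whose values on disjoint sets are
  independent. The probabilities are written out because \<^const>\<open>poisson_pmf\<close> requires a strictly
  positive parameter.\<close>

definition poisson_point_process :: "'m measure \<Rightarrow> ('m \<Rightarrow> 'w measure) \<Rightarrow> 'w measure \<Rightarrow> bool" where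
  "poisson_point_process M \<eta> \<Lambda> \<longleftrightarrow>
     prob_space M \<and>
     (\<forall>m\<in>space M. sets (\<eta> m) = sets \<Lambda> \<and> (\<forall>A\<in>sets \<Lambda>. emeasure (\<eta> m) A \<in> insert \<infinity> \<nat>)) \<and>
     (\<forall>A\<in>sets \<Lambda>. (\<lambda>m. emeasure (\<eta> m) A) \<in> borel_measurable M) \<and>
     (\<forall>A\<in>sets \<Lambda>. emeasure \<Lambda> A < \<infinity> \<longrightarrow>
        (\<forall>k::nat. measure M {m \<in> space M. emeasure (\<eta> m) A = of_nat k} =
                  exp (- measure \<Lambda> A) * measure \<Lambda> A ^ k / fact k)) \<and>
     (\<forall>A\<in>sets \<Lambda>. emeasure \<Lambda> A = \<infinity> \<longrightarrow> (AE m in M. emeasure (\<eta> m) A = \<infinity>)) \<and>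
     (\<forall>(I :: nat set) A. finite I \<longrightarrow> A ` I \<subseteq> sets \<Lambda> \<longrightarrow> disjoint_family_on A I \<longrightarrow>
        prob_space.indep_vars M (\<lambda>_. borel) (\<lambda>i m. emeasure (\<eta> m) (A i)) I)"

definition orbit_walls ::
    "('a, 'b) monoid_scheme \<Rightarrow> ('a \<Rightarrow> 'x \<Rightarrow> 'x) \<Rightarrow> 'x set set measure \<Rightarrow> 'x \<Rightarrow> 'x set set set" where
  "orbit_walls G \<phi> \<mu> x\<^sub>0 =
     (\<Union>g\<in>carrier G. \<Union>h\<in>carrier G. walls_between \<mu> (\<phi> g x\<^sub>0) (\<phi> h x\<^sub>0))"

text \<open>The edges not separated by any wall of the configuration \<open>N\<close>.\<close>

definition open_edges ::
    "('a, 'b) monoid_scheme \<Rightarrow> 'a set \<Rightarrow> ('a \<Rightarrow> 'x \<Rightarrow> 'x) \<Rightarrow> 'x set set measure \<Rightarrow> 'x \<Rightarrow>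
     'x set set measure \<Rightarrow> 'a set set" where
  "open_edges G S \<phi> \<mu> x\<^sub>0 N =
     {{g, h} | g h. g \<in> carrier G \<and> h \<in> carrier G \<and> {g, h} \<in> cayley_edges G S \<and>
                    emeasure N (walls_between \<mu> (\<phi> g x\<^sub>0) (\<phi> h x\<^sub>0)) = 0}"

text \<open>\<open>P\<close> is the law of the random edge set obtained from a Poisson point process \<open>\<eta>\<close> on the
  walls separating points of the orbit of \<open>x\<^sub>0\<close>, with intensity \<open>(1 - p) \<mu>\<close>. This law does not
  depend on the choice of \<open>\<eta>\<close>. Taking measures on the set of walls as sample points loses no
  generality, since every point process can be realized on its canonical space.\<close>

definition poisson_wall_percolation ::
    "('a, 'b) monoid_scheme \<Rightarrow> 'a set \<Rightarrow> ('a \<Rightarrow> 'x \<Rightarrow> 'x) \<Rightarrow> 'x set set measure \<Rightarrow> 'x \<Rightarrow> real \<Rightarrow>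
     'a set set measure \<Rightarrow> bool" where
  "poisson_wall_percolation G S \<phi> \<mu> x\<^sub>0 p P \<longleftrightarrow>
     (\<exists>(M :: 'x set set measure measure) \<eta>.
        poisson_point_process M \<eta>
          (scale_measure (ennreal (1 - p)) (restrict_space \<mu> (orbit_walls G \<phi> \<mu> x\<^sub>0))) \<and>
        P = distr M (edge_configs (cayley_edges G S)) (\<lambda>m. open_edges G S \<phi> \<mu> x\<^sub>0 (\<eta> m)))"

end

theory Submission
  imports Defs
begin

text \<open>Amenability gives finite sets \<open>F\<^sub>n\<close> with \<open>\<bar>gF\<^sub>n - F\<^sub>n\<bar> / \<bar>F\<^sub>n\<bar>\<close> summable in \<open>n\<close> for every \<open>g\<close>.
  Let \<open>\<Gamma>\<close> act on itself, take as walls all translates of the \<open>F\<^sub>n\<^sup>-\<^sup>1\<close> (with their complements) and give each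
  translate of \<open>F\<^sub>n\<^sup>-\<^sup>1\<close> the weight \<open>1 / \<bar>F\<^sub>n\<bar>\<close>. The walls separating \<open>x\<close> from \<open>y\<close> have mass at most
  \<open>\<Sum>\<^sub>n (\<bar>y\<^sup>-\<^sup>1xF\<^sub>n - F\<^sub>n\<bar> + \<bar>x\<^sup>-\<^sup>1yF\<^sub>n - F\<^sub>n\<bar>) / \<bar>F\<^sub>n\<bar> < \<infinity>\<close>, so an edge \<open>e\<close> is open with probability
  \<open>exp (- (1 - p) w(e))\<close>, which tends to \<open>1\<close> as \<open>p\<close> does. On the other hand each vertex lies on the finite side
  of \<open>\<bar>F\<^sub>n\<bar>\<close> translates for every \<open>n\<close>, hence of walls of total mass \<open>\<Sum>\<^sub>n 1 = \<infinity>\<close>; almost surely one of them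
  is in the Poisson process and encloses the cluster of the vertex. Invariance of the law follows from the void
  probabilities, since the events \<open>K \<subseteq> \<omega>\<close> with \<open>K\<close> finite generate the \<open>\<sigma>\<close>-algebra.

  The Folner sets are obtained combinatorially: if every finite \<open>F\<close> satisfied \<open>\<bar>KF\<bar> \<ge> 2\<bar>F\<bar>\<close> for a fixed finite
  \<open>K\<close>, Hall's marriage theorem would give a paradoxical decomposition and the invariant mean of \<open>\<Gamma>\<close> would be
  at least \<open>2\<close>.\<close>

section \<open>Hall's theorem for locally finite relations\<close>

text \<open>Zorn is applied to the sets \<open>C\<close> of deleted pairs that leave Hall's
  condition intact. By local finiteness only finitely many pairs of \<open>R\<close> start in a
  finite \<open>J\<close>, so all deletions by a chain that matter for \<open>J\<close> already
  occur in one member of the chain. Hence the union of the chain is admissible, and a maximal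
  \<open>C\<close> leaves a relation in which every pair is critical.\<close>

lemma minimal_hall_relation:
  fixes R :: "('i \<times> 'v) set"
  assumes fin: "\<And>i. i \<in> I \<Longrightarrow> finite (R `` {i})"
    and hall: "\<And>J. finite J \<Longrightarrow> J \<subseteq> I \<Longrightarrow> card J \<le> card (R `` J)"
  shows "\<exists>Q\<subseteq>R. (\<forall>J. finite J \<longrightarrow> J \<subseteq> I \<longrightarrow> card J \<le> card (Q `` J)) \<and>
    (\<forall>e\<in>Q. \<exists>J. finite J \<and> J \<subseteq> I \<and> card ((Q - {e}) `` J) < card J)"
proof -
  define \<A> where "\<A> = {C. \<forall>J. finite J \<longrightarrow> J \<subseteq> I \<longrightarrow> card J \<le> card ((R - C) `` J)}"
  have "\<exists>M\<in>\<A>. \<forall>X\<in>\<A>. M \<subseteq> X \<longrightarrow> X = M"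
  proof (rule subset_Zorn')
    fix \<C> assume ch: "subset.chain \<A> \<C>"
    show "\<Union>\<C> \<in> \<A>"
    proof (cases "\<C> = {}")
      case True
      then show ?thesis using hall by (auto simp: \<A>_def)
    next
      case False
      have "card J \<le> card ((R - \<Union>\<C>) `` J)" if J: "finite J" "J \<subseteq> I" for J
      proof -
        have "R \<inter> J \<times> UNIV \<subseteq> Sigma J (\<lambda>i. R `` {i})"
          by auto
        then have "finite (R \<inter> J \<times> UNIV \<inter> \<Union>\<C>)"
          using J fin by (intro finite_Int disjI1 finite_subset[OF _ finite_SigmaI]) auto
        then obtain C where C: "C \<in> \<C>" "R \<inter> J \<times> UNIV \<inter> \<Union>\<C> \<subseteq> C"
          using finite_subset_Union_chain[of "R \<inter> J \<times> UNIV \<inter> \<Union>\<C>" \<C> \<A>] ch False by auto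
        have "(R - \<Union>\<C>) `` J = (R - C) `` J"
          using C by blast
        moreover have "C \<in> \<A>"
          using C ch by (auto simp: subset.chain_def)
        ultimately show ?thesis
          using J by (auto simp: \<A>_def)
      qed
      then show ?thesis by (auto simp: \<A>_def)
    qed
  qed
  then obtain C where C: "C \<in> \<A>" and max: "\<And>D. D \<in> \<A> \<Longrightarrow> C \<subseteq> D \<Longrightarrow> D = C"
    by blast
  show ?thesis
  proof (intro exI[of _ "R - C"] conjI allI ballI impI)
    show "R - C \<subseteq> R" by blast
    show "card J \<le> card ((R - C) `` J)" if "finite J" "J \<subseteq> I" for J
      using C that by (auto simp: \<A>_def)
    show "\<exists>J. finite J \<and> J \<subseteq> I \<and> card ((R - C - {e}) `` J) < card J" if "e \<in> R - C" for e
    proof -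
      have "insert e C \<notin> \<A>" using max[of "insert e C"] that by blast
      moreover have "R - insert e C = R - C - {e}" by blast
      ultimately show ?thesis by (auto simp: \<A>_def not_le)
    qed
  qed
qed

text \<open>Rado's argument: in a minimal relation satisfying Hall's condition every index has exactly one
  partner, since two violating sets for two different deletions at the same index could be
  uncrossed.\<close>

lemma hall_locally_finite:
  fixes R :: "('i \<times> 'v) set"
  assumes fin: "\<And>i. i \<in> I \<Longrightarrow> finite (R `` {i})"
    and hall: "\<And>J. finite J \<Longrightarrow> J \<subseteq> I \<Longrightarrow> card J \<le> card (R `` J)"
  obtains f where "inj_on f I" and "\<And>i. i \<in> I \<Longrightarrow> (i, f i) \<in> R"
proof -
  obtain Q where QR: "Q \<subseteq> R"
    and hallQ: "\<And>J. finite J \<Longrightarrow> J \<subseteq> I \<Longrightarrow> card J \<le> card (Q `` J)"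
    and crit: "\<And>e. e \<in> Q \<Longrightarrow> \<exists>J. finite J \<and> J \<subseteq> I \<and> card ((Q - {e}) `` J) < card J"
    using minimal_hall_relation[of I R] fin hall by metis
  have finQ: "finite (Q `` J)" if "finite J" "J \<subseteq> I" for J
  proof -
    have "Q `` J \<subseteq> R `` J" using QR by (rule Image_mono) simp
    moreover have "finite (R `` J)" using that fin by (subst Image_eq_UN) (intro finite_UN_I, auto)
    ultimately show ?thesis by (rule finite_subset)
  qed
  \<comment> \<open>A set that violates Hall's condition after deleting \<open>(i, x)\<close> must
    contain \<open>i\<close>. Removing \<open>i\<close> from it costs one element, so the strict
    inequality becomes a weak one for the rest \<open>K\<close>.\<close>
  have crit': "\<exists>K. finite K \<and> K \<subseteq> I \<and> i \<notin> K \<and> card (Q `` K \<union> (Q `` {i} - {x})) \<le> card K"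
    if e: "(i, x) \<in> Q" for i x
  proof -
    obtain J where J: "finite J" "J \<subseteq> I" "card ((Q - {(i, x)}) `` J) < card J"
      using crit[OF e] by blast
    have "i \<in> J"
    proof (rule ccontr)
      assume "i \<notin> J"
      then have "(Q - {(i, x)}) `` J = Q `` J" by blast
      then show False using J(3) hallQ[OF J(1,2)] by simp
    qed
    then have "(Q - {(i, x)}) `` J = Q `` (J - {i}) \<union> (Q `` {i} - {x})" by blast
    moreover have "card J = Suc (card (J - {i}))"
      using J(1) \<open>i \<in> J\<close> by (rule card.remove)
    ultimately have "card (Q `` (J - {i}) \<union> (Q `` {i} - {x})) \<le> card (J - {i})"
      using J(3) by simp
    then show ?thesis using J(1,2) by blast
  qed
  have uniq: "x = y" if i: "i \<in> I" and x: "(i, x) \<in> Q" and y: "(i, y) \<in> Q" for i x y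
  proof (rule ccontr)
    assume "x \<noteq> y"
    obtain K where K: "finite K" "K \<subseteq> I" "i \<notin> K" "card (Q `` K \<union> (Q `` {i} - {x})) \<le> card K"
      using crit'[OF x] by blast
    obtain L where L: "finite L" "L \<subseteq> I" "i \<notin> L" "card (Q `` L \<union> (Q `` {i} - {y})) \<le> card L"
      using crit'[OF y] by blast
    \<comment> \<open>Submodularity: since \<open>x\<close> and \<open>y\<close> differ, the union
      of \<open>?U\<close> and \<open>?V\<close> recovers all partners of \<open>i\<close>, so
      Hall's condition for \<open>insert i (K \<union> L)\<close> gains one. The intersection still
      contains the partners of \<open>K \<inter> L\<close>. Adding up contradicts the choice of
      \<open>K\<close> and \<open>L\<close>.\<close>
    let ?U = "Q `` K \<union> (Q `` {i} - {x})" and ?V = "Q `` L \<union> (Q `` {i} - {y})"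
    have fUV: "finite ?U" "finite ?V"
      using finQ[OF K(1,2)] finQ[OF L(1,2)] finQ[of "{i}"] i by auto
    have "?U \<union> ?V = Q `` insert i (K \<union> L)"
      using \<open>x \<noteq> y\<close> by auto
    then have "Suc (card (K \<union> L)) \<le> card (?U \<union> ?V)"
      using hallQ[of "insert i (K \<union> L)"] K L i by simp
    moreover have "card (K \<inter> L) \<le> card (?U \<inter> ?V)"
    proof -
      have "card (K \<inter> L) \<le> card (Q `` (K \<inter> L))"
        using hallQ K L by (simp add: le_infI1)
      also have "\<dots> \<le> card (?U \<inter> ?V)"
        using fUV by (intro card_mono) auto
      finally show ?thesis .
    qed
    moreover have "card ?U + card ?V = card (?U \<union> ?V) + card (?U \<inter> ?V)"
      using fUV by (rule card_Un_Int)
    moreover have "card K + card L = card (K \<union> L) + card (K \<inter> L)"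
      using K L by (intro card_Un_Int)
    ultimately show False using K(4) L(4) by linarith
  qed
  have "\<exists>x. (i, x) \<in> Q" if "i \<in> I" for i
  proof (rule ccontr)
    assume "\<nexists>x. (i, x) \<in> Q"
    then have "Q `` {i} = {}" by blast
    then show False using hallQ[of "{i}"] that by simp
  qed
  then obtain f where f: "\<And>i. i \<in> I \<Longrightarrow> (i, f i) \<in> Q" by metis
  show ?thesis
  proof
    show "(i, f i) \<in> R" if "i \<in> I" for i using f QR that by blast
    show "inj_on f I"
    proof (rule inj_onI, rule ccontr)
      fix i j assume ij: "i \<in> I" "j \<in> I" "f i = f j" "i \<noteq> j"
      \<comment> \<open>With unique partners, \<open>f i = f j\<close> would leave the two indices
        \<open>i\<close> and \<open>j\<close> only one partner together.\<close>
      have "x = f i" if "x \<in> Q `` {i, j}" for x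
      proof -
        have "(i, x) \<in> Q \<or> (j, x) \<in> Q" using that by blast
        then show ?thesis using uniq f ij(1-3) by metis
      qed
      then have "card (Q `` {i, j}) \<le> card {f i}"
        by (intro card_mono) blast+
      moreover have "card {i, j} \<le> card (Q `` {i, j})"
        using ij by (intro hallQ) auto
      ultimately show False using ij by simp
    qed
  qed
qed

section \<open>Folner sets in amenable groups\<close>

context group begin

lemma mult_card_l_coset:
  assumes "g \<in> carrier G" "A \<subseteq> carrier G"
  shows "card (g <# A) = card A"
proof -
  have "g <# A = (\<lambda>x. g \<otimes> x) ` A" by (auto simp: l_coset_def)
  then show ?thesis
    using assms by (simp add: card_image inj_on_def subset_iff)
qed

text \<open>Doubling by \<open>K\<close> is Hall's condition for matching two copies of the group,
  indexed by \<open>bool\<close>, into one copy, each point moving by a left multiplication from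
  \<open>K\<close>. Such a matching is a paradoxical decomposition, which an invariant mean
  excludes.\<close>

lemma amenable_not_doubling:
  assumes am: "amenable G" and K: "finite K" "K \<subseteq> carrier G"
  obtains F where "finite F" "F \<noteq> {}" "F \<subseteq> carrier G" "card (K <#> F) < 2 * card F"
proof (rule ccontr)
  note witness = that
  assume no: "\<not> thesis"
  have dbl: "2 * card F \<le> card (K <#> F)" if "finite F" "F \<subseteq> carrier G" for F
    using no witness[of F] that by (cases "F = {}") (auto simp: not_less[symmetric])
  define R where "R = {((x, b :: bool), k \<otimes> x) | x b k. x \<in> carrier G \<and> k \<in> K}"
  obtain f where inj: "inj_on f (carrier G \<times> UNIV)" and fR: "\<And>i. i \<in> carrier G \<times> UNIV \<Longrightarrow> (i, f i) \<in> R"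
  proof (rule hall_locally_finite[of "carrier G \<times> (UNIV :: bool set)" R])
    fix i :: "'a \<times> bool" assume "i \<in> carrier G \<times> UNIV"
    have "R `` {i} \<subseteq> (\<lambda>k. k \<otimes> fst i) ` K" by (auto simp: R_def)
    then show "finite (R `` {i})" using K finite_surj by blast
  next
    fix J :: "('a \<times> bool) set" assume J: "finite J" "J \<subseteq> carrier G \<times> UNIV"
    have "J \<subseteq> fst ` J \<times> UNIV" by force
    then have "card J \<le> card (fst ` J \<times> (UNIV :: bool set))"
      using J by (intro card_mono) auto
    also have "\<dots> = 2 * card (fst ` J)" by (simp add: card_cartesian_product)
    also have "\<dots> \<le> card (K <#> fst ` J)" using J by (intro dbl) auto
    also have "K <#> fst ` J = R `` J"
      using J by (force simp: R_def set_mult_def)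
    finally show "card J \<le> card (R `` J)" .
  next
    fix f assume "inj_on f (carrier G \<times> (UNIV :: bool set))" "\<And>i. i \<in> carrier G \<times> UNIV \<Longrightarrow> (i, f i) \<in> R"
    then show ?thesis by (rule that)
  qed
  have "\<exists>k\<in>K. f (x, b) = k \<otimes> x" if "x \<in> carrier G" for x b
    using fR[of "(x, b)"] that by (auto simp: R_def)
  then obtain \<kappa> where \<kappa>: "\<And>x b. x \<in> carrier G \<Longrightarrow> \<kappa> x b \<in> K" "\<And>x b. x \<in> carrier G \<Longrightarrow> f (x, b) = \<kappa> x b \<otimes> x"
    by metis
  obtain m :: "'a set \<Rightarrow> real" where m: "(\<forall>A. A \<subseteq> carrier G \<longrightarrow> 0 \<le> m A) \<and> m (carrier G) = 1 \<and>
      (\<forall>A B. A \<subseteq> carrier G \<longrightarrow> B \<subseteq> carrier G \<longrightarrow> A \<inter> B = {} \<longrightarrow> m (A \<union> B) = m A + m B) \<and>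
      (\<forall>g\<in>carrier G. \<forall>A. A \<subseteq> carrier G \<longrightarrow> m (g <# A) = m A)"
    using am unfolding amenable_def by (rule exE)
  then have m_nonneg: "\<And>A. A \<subseteq> carrier G \<Longrightarrow> 0 \<le> m A"
    and m_one: "m (carrier G) = 1"
    and m_add: "\<And>A B. A \<subseteq> carrier G \<Longrightarrow> B \<subseteq> carrier G \<Longrightarrow> A \<inter> B = {} \<Longrightarrow> m (A \<union> B) = m A + m B"
    and m_inv: "\<And>g A. g \<in> carrier G \<Longrightarrow> A \<subseteq> carrier G \<Longrightarrow> m (g <# A) = m A"
    by blast+
  have m_empty: "m {} = 0" using m_add[of "{}" "{}"] by simp
  have m_sum: "m (\<Union>i\<in>I. B i) = (\<Sum>i\<in>I. m (B i))"
    if "finite I" "\<And>i. i \<in> I \<Longrightarrow> B i \<subseteq> carrier G" "disjoint_family_on B I" for I :: "('a \<times> bool) set" and B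
    using that
  proof (induction I)
    case (insert i I)
    have "B i \<inter> (\<Union>i\<in>I. B i) = {}"
      using insert by (auto simp: disjoint_family_on_def)
    then have "m (B i \<union> (\<Union>i\<in>I. B i)) = m (B i) + m (\<Union>i\<in>I. B i)"
      using insert by (intro m_add) auto
    then show ?case using insert by (simp add: disjoint_family_on_insert)
  qed (simp add: m_empty)
  \<comment> \<open>\<open>B (k, b)\<close> collects the points of copy \<open>b\<close> that the
    matching moves by \<open>k\<close>; for each \<open>b\<close> these pieces partition the group.
    Their translates \<open>C (k, b)\<close> are pairwise disjoint over both copies, because
    \<open>f\<close> is injective.\<close>
  define B where "B = (\<lambda>(k, b). {x \<in> carrier G. \<kappa> x b = k})"
  have B_sub: "B i \<subseteq> carrier G" for i by (auto simp: B_def split: prod.splits)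
  define C where "C = (\<lambda>(k, b). k <# B (k, b))"
  have C_eq: "C (k, b) = (\<lambda>x. f (x, b)) ` B (k, b)" if "k \<in> K" for k b
  proof -
    have "C (k, b) = (\<lambda>x. k \<otimes> x) ` B (k, b)" by (auto simp: C_def l_coset_def)
    also have "\<dots> = (\<lambda>x. f (x, b)) ` B (k, b)" using \<kappa>(2) by (intro image_cong refl) (auto simp: B_def)
    finally show ?thesis .
  qed
  have C_sub: "C i \<subseteq> carrier G" if "i \<in> K \<times> UNIV" for i
  proof -
    obtain k b where "i = (k, b)" by fastforce
    then show ?thesis
      using that K l_coset_subset_G[OF B_sub, of k "(k, b)"] by (auto simp: C_def simp del: l_coset_subset_G)
  qed
  have "m (\<Union>k\<in>K. B (k, b)) = (\<Sum>k\<in>K. m (B (k, b)))" for b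
  proof -
    have "m (\<Union>i\<in>K \<times> {b}. B i) = (\<Sum>i\<in>K \<times> {b}. m (B i))"
      using K B_sub by (intro m_sum) (auto simp: B_def disjoint_family_on_def)
    moreover have "(\<Union>i\<in>K \<times> {b}. B i) = (\<Union>k\<in>K. B (k, b))" by auto
    moreover have "(\<Sum>i\<in>K \<times> {b}. m (B i)) = (\<Sum>k\<in>K. m (B (k, b)))"
      by (simp add: sum.cartesian_product')
    ultimately show ?thesis by simp
  qed
  moreover have "(\<Union>k\<in>K. B (k, b)) = carrier G" for b
    using \<kappa>(1) by (auto simp: B_def)
  ultimately have one: "(\<Sum>k\<in>K. m (B (k, b))) = 1" for b
    using m_one by metis
  \<comment> \<open>Each copy has mean 1, invariance preserves the mean of every piece, and the
    disjoint translates fit into a group of mean 1.\<close>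
  have "2 = (\<Sum>i\<in>K \<times> (UNIV :: bool set). m (B i))"
    using one by (simp add: sum.cartesian_product' UNIV_bool sum.distrib)
  also have "\<dots> = (\<Sum>i\<in>K \<times> (UNIV :: bool set). m (C i))"
    using K B_sub m_inv by (intro sum.cong) (auto simp: C_def)
  also have "\<dots> = m (\<Union>i\<in>K \<times> UNIV. C i)"
  proof (rule m_sum[symmetric])
    show "disjoint_family_on C (K \<times> UNIV)"
    proof (unfold disjoint_family_on_def, intro ballI impI, rule ccontr)
      fix i j assume ij: "i \<in> K \<times> (UNIV :: bool set)" "j \<in> K \<times> (UNIV :: bool set)" "i \<noteq> j" "C i \<inter> C j \<noteq> {}"
      obtain k b l c where kl: "i = (k, b)" "j = (l, c)" by fastforce
      obtain x y where xy: "x \<in> B (k, b)" "y \<in> B (l, c)" "f (x, b) = f (y, c)"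
        using ij C_eq unfolding kl by fastforce
      then have "x = y" "b = c"
        using inj by (auto simp: inj_on_def B_def)
      then show False using ij xy unfolding kl by (auto simp: B_def)
    qed
  qed (use K C_sub in auto)
  also have "\<dots> \<le> m (\<Union>i\<in>K \<times> UNIV. C i) + m (carrier G - (\<Union>i\<in>K \<times> UNIV. C i))"
    using m_nonneg by simp
  also have "\<dots> = m ((\<Union>i\<in>K \<times> UNIV. C i) \<union> (carrier G - (\<Union>i\<in>K \<times> UNIV. C i)))"
    using C_sub by (intro m_add[symmetric]) auto
  also have "(\<Union>i\<in>K \<times> UNIV. C i) \<union> (carrier G - (\<Union>i\<in>K \<times> UNIV. C i)) = carrier G"
    using C_sub by blast
  finally show False using m_one by simp
qed

lemma finite_set_mult:
  assumes "finite A" "finite B"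
  shows "finite (A <#> B)"
proof -
  have "A <#> B = (\<lambda>(a, b). a \<otimes> b) ` (A \<times> B)" by (auto simp: set_mult_def)
  then show ?thesis using assms by simp
qed

text \<open>Without such a set, multiplication by \<open>T\<close>, which is \<open>S\<close> with
  the identity, would expand every finite set by the factor \<open>1 + \<epsilon>\<close>. Iterating
  until \<open>(1 + \<epsilon>) ^ n\<close> exceeds 2 makes the finite set \<open>T^n\<close>
  doubling.\<close>

lemma amenable_folner:
  assumes am: "amenable G" and S: "finite S" "S \<subseteq> carrier G" and \<epsilon>: "(\<epsilon> :: real) > 0"
  obtains F where "finite F" "F \<noteq> {}" "F \<subseteq> carrier G"
    "\<And>s. s \<in> S \<Longrightarrow> real (card ((s <# F) - F)) \<le> \<epsilon> * real (card F)"
proof (rule ccontr)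
  note witness = that
  assume no: "\<not> thesis"
  have bad: "\<exists>s\<in>S. real (card ((s <# F) - F)) > \<epsilon> * real (card F)"
    if "finite F" "F \<subseteq> carrier G" "F \<noteq> {}" for F
    using no witness[of F] that by (metis not_le)
  \<comment> \<open>The identity is adjoined so that the product set contains \<open>F\<close> as
    well as the new points of \<open>s <# F\<close>.\<close>
  define T where "T = insert \<one> S"
  have T: "finite T" "T \<subseteq> carrier G" using S by (auto simp: T_def)
  have grow: "(1 + \<epsilon>) * card F \<le> card (T <#> F)" if F: "finite F" "F \<subseteq> carrier G" for F
  proof (cases "F = {}")
    case False
    then obtain s where s: "s \<in> S" "real (card ((s <# F) - F)) > \<epsilon> * real (card F)"
      using bad F by blast
    have "F \<union> ((s <# F) - F) \<subseteq> T <#> F"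
      using F s by (force simp: T_def set_mult_def l_coset_def)
    then have "card (F \<union> ((s <# F) - F)) \<le> card (T <#> F)"
      using finite_set_mult[of T F] T F by (intro card_mono)
    moreover have "card (F \<union> ((s <# F) - F)) = card F + card ((s <# F) - F)"
      using F by (intro card_Un_disjoint) (auto simp: l_coset_def)
    ultimately show ?thesis using s by (simp add: algebra_simps)
  qed (auto simp: set_mult_def)
  \<comment> \<open>The \<open>n\<close>-fold product set of \<open>T\<close>, with
    \<open>P 0\<close> the trivial subgroup.\<close>
  define P where "P n = ((\<lambda>A. T <#> A) ^^ n) {\<one>}" for n
  have P: "finite (P n)" "P n \<subseteq> carrier G" for n
    by (induction n) (auto simp: P_def T finite_set_mult set_mult_closed)
  have P_Suc: "P (Suc n) = T <#> P n" for n by (simp add: P_def)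
  have P0: "P 0 <#> F = F" if "F \<subseteq> carrier G" for F
    using that by (auto simp: P_def set_mult_def) (metis l_one subsetD)
  have growP: "(1 + \<epsilon>) ^ n * card F \<le> card (P n <#> F)" if F: "finite F" "F \<subseteq> carrier G" for F n
  proof (induction n)
    case (Suc n)
    have "(1 + \<epsilon>) ^ Suc n * card F \<le> (1 + \<epsilon>) * card (P n <#> F)"
      using Suc \<epsilon> by simp
    also have "\<dots> \<le> card (T <#> (P n <#> F))"
      using P F by (intro grow) (auto simp: finite_set_mult set_mult_closed)
    also have "T <#> (P n <#> F) = P (Suc n) <#> F"
      using T P F by (simp add: P_Suc set_mult_assoc)
    finally show ?case .
  qed (use P0 F in simp)
  obtain n where n: "2 < (1 + \<epsilon>) ^ n"
    using real_arch_pow[of "1 + \<epsilon>" 2] \<epsilon> by auto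
  obtain F where F: "finite F" "F \<noteq> {}" "F \<subseteq> carrier G" "card (P n <#> F) < 2 * card F"
    using amenable_not_doubling[OF am P[of n]] by blast
  have "2 * real (card F) \<le> (1 + \<epsilon>) ^ n * card F"
    using n by (intro mult_right_mono) auto
  also have "\<dots> \<le> card (P n <#> F)" by (rule growP[OF F(1,3)])
  finally show False using F(4) by linarith
qed

text \<open>Products of words over \<open>S\<close> and the inverses of \<open>S\<close> exhaust the
  generated subgroup. Countability of the group is what later makes the space of walls
  countable.\<close>

lemma countable_generate:
  assumes "countable S" "S \<subseteq> carrier G"
  shows "countable (generate G S)"
proof -
  define T where "T = S \<union> (\<lambda>s. inv s) ` S"
  have T: "T \<subseteq> carrier G" "countable T" using assms by (auto simp: T_def)
  have cl: "foldr (\<otimes>) w \<one> \<in> carrier G" if "w \<in> lists T" for w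
    using that T by (induction w) auto
  have app: "foldr (\<otimes>) (v @ w) \<one> = foldr (\<otimes>) v \<one> \<otimes> foldr (\<otimes>) w \<one>" if "v \<in> lists T" "w \<in> lists T" for v w
    using that(1)
  proof (induction v)
    case (Cons a v)
    then show ?case using T cl[of v] cl[of w] that(2) by (auto simp: m_assoc subset_iff)
  qed (use cl[of w] that(2) in simp)
  have "x \<in> (\<lambda>w. foldr (\<otimes>) w \<one>) ` lists T" if "x \<in> generate G S" for x
    using that
  proof induction
    case one
    then show ?case by (intro image_eqI[of _ _ "[]"]) auto
  next
    case (incl h)
    then show ?case using assms by (intro image_eqI[of _ _ "[h]"]) (auto simp: T_def)
  next
    case (inv h)
    then show ?case using assms by (intro image_eqI[of _ _ "[inv h]"]) (auto simp: T_def)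
  next
    case (eng x y)
    then obtain v w where "v \<in> lists T" "w \<in> lists T" "x = foldr (\<otimes>) v \<one>" "y = foldr (\<otimes>) w \<one>"
      by blast
    then show ?case by (intro image_eqI[of _ _ "v @ w"]) (auto simp: app simp del: foldr_append)
  qed
  then have "generate G S \<subseteq> (\<lambda>w. foldr (\<otimes>) w \<one>) ` lists T" by blast
  then show ?thesis using T by (meson countable_image countable_lists countable_subset)
qed

text \<open>\<open>F n\<close> is chosen almost invariant, up to \<open>(1 / 2) ^ n\<close>, under
  the elements numbered \<open>0\<close> to \<open>n\<close>. The element \<open>e i\<close> is
  controlled only from \<open>n = i\<close> on; for smaller \<open>n\<close> the trivial bound by
  the size of \<open>F n\<close> suffices, at the price of the constant
  \<open>2 ^ i\<close>.\<close>

lemma amenable_folner_sequence: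
  assumes am: "amenable G" and cnt: "countable (carrier G)"
  shows "\<exists>F :: nat \<Rightarrow> 'a set. (\<forall>n. finite (F n) \<and> F n \<noteq> {} \<and> F n \<subseteq> carrier G) \<and>
    (\<forall>g\<in>carrier G. \<exists>C. \<forall>n. real (card ((g <# F n) - F n)) \<le> C * (1 / 2) ^ n * card (F n))"
proof -
  define e where "e = from_nat_into (carrier G)"
  have e: "range e = carrier G"
    unfolding e_def using cnt by (intro range_from_nat_into) auto
  have "\<exists>F. finite F \<and> F \<noteq> {} \<and> F \<subseteq> carrier G \<and>
      (\<forall>s\<in>e ` {..n}. real (card ((s <# F) - F)) \<le> (1 / 2) ^ n * card F)" for n :: nat
    by (rule amenable_folner[OF am, of "e ` {..n}" "(1 / 2) ^ n"]) (use e in auto)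
  then obtain F where F: "\<And>n :: nat. finite (F n)" "\<And>n. F n \<noteq> {}" "\<And>n. F n \<subseteq> carrier G"
    "\<And>n s. s \<in> e ` {..n} \<Longrightarrow> real (card ((s <# F n) - F n)) \<le> (1 / 2) ^ n * card (F n)"
    by metis
  show ?thesis
  proof (intro exI[of _ F] conjI allI ballI F(1-3))
    fix g assume g: "g \<in> carrier G"
    then obtain i where i: "g = e i" using e by blast
    have "real (card ((g <# F n) - F n)) \<le> 2 ^ i * (1 / 2) ^ n * card (F n)" for n
    proof (cases "i \<le> n")
      case True
      then have "real (card ((g <# F n) - F n)) \<le> (1 / 2) ^ n * card (F n)"
        using F(4) i by auto
      also have "\<dots> \<le> 2 ^ i * ((1 / 2) ^ n * card (F n))"
        using mult_right_mono[of 1 "2 ^ i" "(1 / 2) ^ n * real (card (F n))"] by simp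
      finally show ?thesis by (simp add: mult.assoc)
    next
      case False
      have "card ((g <# F n) - F n) \<le> card (g <# F n)"
        using F(1) by (intro card_mono) (auto simp: l_coset_def)
      then have "real (card ((g <# F n) - F n)) \<le> real 1 * real (card (F n))"
        using mult_card_l_coset[OF g F(3)] by simp
      also have "\<dots> \<le> 2 ^ i * (1 / 2) ^ n * card (F n)"
      proof (rule mult_right_mono)
        have "2 ^ i * (1 / 2) ^ n = (2 :: real) ^ (i - n)"
          using False by (simp add: power_diff power_one_over)
        then show "real 1 \<le> 2 ^ i * (1 / 2) ^ n" by simp
      qed simp
      finally show ?thesis .
    qed
    then show "\<exists>C. \<forall>n. real (card ((g <# F n) - F n)) \<le> C * (1 / 2) ^ n * card (F n)" by blast
  qed
qed

end

section \<open>Poisson processes on countable spaces\<close>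

lemma (in prob_space) indep_vars_distr:
  assumes H: "H \<in> measurable M N"
    and X: "\<And>i. i \<in> I \<Longrightarrow> X i \<in> measurable N (M' i)"
    and ind: "indep_vars M' (\<lambda>i m. X i (H m)) I"
  shows "prob_space.indep_vars (distr M N H) M' X I"
proof (cases "I = {}")
  case True
  interpret D: prob_space "distr M N H" using H by (rule prob_space_distr)
  show ?thesis using True by (simp add: D.indep_vars_def D.indep_sets_def)
next
  case False
  interpret D: prob_space "distr M N H" using H by (rule prob_space_distr)
  have XH: "(\<lambda>m. X i (H m)) \<in> measurable M (M' i)" if "i \<in> I" for i
    using measurable_compose[OF H X[OF that]] .
  have "distr (distr M N H) (Pi\<^sub>M I M') (\<lambda>x. \<lambda>i\<in>I. X i x) = distr M (Pi\<^sub>M I M') (\<lambda>x. \<lambda>i\<in>I. X i (H x))"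
    using X H by (subst distr_distr) (auto simp: comp_def intro!: measurable_restrict)
  also have "\<dots> = (\<Pi>\<^sub>M i\<in>I. distr M (M' i) (\<lambda>m. X i (H m)))"
    using indep_vars_iff_distr_eq_PiM'[OF False XH] ind by simp
  also have "\<dots> = (\<Pi>\<^sub>M i\<in>I. distr (distr M N H) (M' i) (X i))"
    using X H by (intro PiM_cong refl) (simp add: distr_distr comp_def)
  finally show ?thesis
    using X by (subst D.indep_vars_iff_distr_eq_PiM'[OF False]) auto
qed

lemma (in prob_space) indep_vars_cong_space:
  assumes "\<And>i m. i \<in> I \<Longrightarrow> m \<in> space M \<Longrightarrow> X i m = Y i m"
  shows "indep_vars M' X I \<longleftrightarrow> indep_vars M' Y I"
proof -
  have "X i -` A \<inter> space M = Y i -` A \<inter> space M" if "i \<in> I" for i A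
    using assms[OF that] by auto
  moreover have "X i \<in> measurable M (M' i) \<longleftrightarrow> Y i \<in> measurable M (M' i)" if "i \<in> I" for i
    using assms[OF that] by (rule measurable_cong)
  ultimately show ?thesis
    unfolding indep_vars_def2 by (simp cong: indep_sets_cong)
qed

text \<open>The joint map of all coordinates is the identity on the product space, so the joint law
  is the product of the marginals.\<close>

lemma (in product_prob_space) indep_vars_component:
  "prob_space.indep_vars (Pi\<^sub>M I M) M (\<lambda>i x. x i) I"
proof (cases "I = {}")
  case True
  then show ?thesis unfolding P.indep_vars_def P.indep_sets_def by simp
next
  case False
  show ?thesis
  proof (subst P.indep_vars_iff_distr_eq_PiM'[OF False])
    have "distr (Pi\<^sub>M I M) (Pi\<^sub>M I M) (\<lambda>x. \<lambda>i\<in>I. x i) = distr (Pi\<^sub>M I M) (Pi\<^sub>M I M) (\<lambda>x. x)"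
      by (intro distr_cong) (auto simp: space_PiM PiE_restrict)
    also have "\<dots> = (\<Pi>\<^sub>M i\<in>I. distr (Pi\<^sub>M I M) (M i) (\<lambda>x. x i))"
      by (auto simp: PiM_component intro!: PiM_cong)
    finally show "distr (Pi\<^sub>M I M) (Pi\<^sub>M I M) (\<lambda>x. \<lambda>i\<in>I. x i) = (\<Pi>\<^sub>M i\<in>I. distr (Pi\<^sub>M I M) (M i) (\<lambda>x. x i))" .
  qed simp
qed

section \<open>Poisson weights, including rate 0\<close>

definition poisson_weight :: "real \<Rightarrow> nat \<Rightarrow> real" where
  "poisson_weight r k = exp (- r) * r ^ k / fact k"

text \<open>\<^const>\<open>poisson_pmf\<close> is unspecified at rate \<open>0\<close>.\<close>

definition poisson_law :: "real \<Rightarrow> nat pmf" where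
  "poisson_law r = (if r > 0 then poisson_pmf r else return_pmf 0)"

lemma pmf_poisson_law: "r \<ge> 0 \<Longrightarrow> pmf (poisson_law r) k = poisson_weight r k"
  by (cases "r = 0"; cases k) (auto simp: poisson_law_def poisson_weight_def)

text \<open>The binomial theorem: Poisson laws convolve by adding their rates.\<close>

lemma poisson_weight_add:
  "poisson_weight (r + s) k = (\<Sum>i\<le>k. poisson_weight r i * poisson_weight s (k - i))"
proof -
  have e: "exp (- (r + s)) = exp (- r) * exp (- s)"
    using exp_add[of "- r" "- s"] by simp
  have "(\<Sum>i\<le>k. poisson_weight r i * poisson_weight s (k - i)) =
      exp (- (r + s)) / fact k * (\<Sum>i\<le>k. of_nat (k choose i) * r ^ i * s ^ (k - i))"
    unfolding sum_distrib_left e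
    by (intro sum.cong refl) (simp add: poisson_weight_def binomial_fact field_simps)
  then show ?thesis
    by (simp add: poisson_weight_def binomial_ring)
qed

lemma poisson_weight_tendsto_0:
  "((\<lambda>r. poisson_weight r k) \<longlongrightarrow> 0) at_top"
  unfolding poisson_weight_def
  using tendsto_mult_right_zero[OF tendsto_power_div_exp_0[of k], of "inverse (fact k)"]
  by (simp add: exp_minus field_simps)

lemma (in prob_space) prob_sum_nat:
  fixes X Y :: "'a \<Rightarrow> nat"
  assumes ind: "indep_var (count_space UNIV) X (count_space UNIV) Y"
  shows "prob {x \<in> space M. X x + Y x = k} =
    (\<Sum>i\<le>k. prob {x \<in> space M. X x = i} * prob {x \<in> space M. Y x = k - i})"
proof -
  have rv: "X \<in> measurable M (count_space UNIV)" "Y \<in> measurable M (count_space UNIV)"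
    using ind indep_var_rv1 indep_var_rv2 by auto
  have "{x \<in> space M. X x + Y x = k} = (\<Union>i\<le>k. {x \<in> space M. X x \<in> {i} \<and> Y x \<in> {k - i}})"
    by auto
  also have "prob \<dots> = (\<Sum>i\<le>k. prob {x \<in> space M. X x \<in> {i} \<and> Y x \<in> {k - i}})"
    by (intro finite_measure_finite_Union)
      (use rv in \<open>auto simp: disjoint_family_on_def\<close>)
  also have "\<dots> = (\<Sum>i\<le>k. prob {x \<in> space M. X x \<in> {i}} * prob {x \<in> space M. Y x \<in> {k - i}})"
    by (intro sum.cong refl prob_indep_random_variable[OF ind]) auto
  finally show ?thesis by simp
qed


section \<open>Integer-valued measures given by multiplicity functions\<close>

lemma measurable_add_count_space_nat:
  fixes f g :: "'a \<Rightarrow> nat"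
  assumes f: "f \<in> measurable M (count_space UNIV)" and g: "g \<in> measurable M (count_space UNIV)"
  shows "(\<lambda>x. f x + g x) \<in> measurable M (count_space UNIV)"
  by (rule measurable_compose_countable[OF _ f]) (rule measurable_compose[OF g], simp)

lemma measurable_sum_count_space_nat:
  fixes f :: "'i \<Rightarrow> 'a \<Rightarrow> nat"
  assumes "\<And>i. i \<in> I \<Longrightarrow> f i \<in> measurable M (count_space UNIV)"
  shows "(\<lambda>x. \<Sum>i\<in>I. f i x) \<in> measurable M (count_space UNIV)"
  using assms by (induction I rule: infinite_finite_induct) (auto intro: measurable_add_count_space_nat)

text \<open>Each point \<open>w\<close> is replaced by \<open>f w\<close> copies and the copies are
  counted. Additivity and the value infinity are thus inherited from the counting measure.\<close>

definition multiplicity_mass :: "('w \<Rightarrow> nat) \<Rightarrow> 'w set \<Rightarrow> ennreal" where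
  "multiplicity_mass f A = emeasure (count_space UNIV) (SIGMA w:A. {..<f w})"

definition multiplicity_measure :: "'w set \<Rightarrow> ('w \<Rightarrow> nat) \<Rightarrow> 'w measure" where
  "multiplicity_measure W f = distr (count_space (SIGMA w:W. {..<f w})) (count_space W) fst"

lemma sets_multiplicity_measure [simp]: "sets (multiplicity_measure W f) = Pow W"
  by (simp add: multiplicity_measure_def)

lemma emeasure_multiplicity_measure:
  assumes "A \<subseteq> W"
  shows "emeasure (multiplicity_measure W f) A = multiplicity_mass f A"
proof -
  have "emeasure (multiplicity_measure W f) A =
      emeasure (count_space (SIGMA w:W. {..<f w})) (fst -` A \<inter> (SIGMA w:W. {..<f w}))"
    unfolding multiplicity_measure_def using assms by (subst emeasure_distr) auto
  also have "fst -` A \<inter> (SIGMA w:W. {..<f w}) = (SIGMA w:A. {..<f w})"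
    using assms by auto
  also have "emeasure (count_space (SIGMA w:W. {..<f w})) (SIGMA w:A. {..<f w}) = multiplicity_mass f A"
    unfolding multiplicity_mass_def using assms
    by (cases "finite (SIGMA w:A. {..<f w})")
      (simp_all add: emeasure_count_space_finite emeasure_count_space_infinite Sigma_mono)
  finally show ?thesis .
qed

lemma multiplicity_mass_range: "multiplicity_mass f A \<in> insert \<infinity> \<nat>"
  unfolding multiplicity_mass_def by (simp add: emeasure_count_space)

lemma multiplicity_mass_finite:
  "finite A \<Longrightarrow> multiplicity_mass f A = of_nat (\<Sum>w\<in>A. f w)"
  unfolding multiplicity_mass_def by (subst emeasure_count_space_finite) auto

lemma multiplicity_mass_cong:
  "(\<And>w. w \<in> A \<Longrightarrow> f w = g w) \<Longrightarrow> multiplicity_mass f A = multiplicity_mass g A"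
  unfolding multiplicity_mass_def by (metis (mono_tags, lifting) Sigma_cong)

text \<open>For countable \<open>A\<close> an increasing exhaustion by finite sets, along which
  masses become limits of finite sums.\<close>

definition exhaust :: "'w set \<Rightarrow> nat \<Rightarrow> 'w set" where
  "exhaust A n = {w \<in> A. to_nat_on A w < n}"

lemma exhaust_subset: "exhaust A n \<subseteq> A"
  and incseq_exhaust: "incseq (exhaust A)"
  and UN_exhaust: "(\<Union>n. exhaust A n) = A"
  by (auto simp: exhaust_def incseq_def)

lemma finite_exhaust:
  assumes "countable A"
  shows "finite (exhaust A n)"
proof (rule finite_imageD)
  show "finite (to_nat_on A ` exhaust A n)"
    by (rule finite_subset[of _ "{..<n}"]) (auto simp: exhaust_def)
  show "inj_on (to_nat_on A) (exhaust A n)"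
    using inj_on_to_nat_on[OF assms] exhaust_subset by (rule inj_on_subset)
qed

lemma multiplicity_mass_exhaust:
  assumes "countable A"
  shows "multiplicity_mass f A = (SUP n. of_nat (\<Sum>w\<in>exhaust A n. f w))"
proof -
  have "(SIGMA w:A. {..<f w}) = (\<Union>n. SIGMA w:exhaust A n. {..<f w})"
    using UN_exhaust[of A] by auto
  moreover have "(SUP n. multiplicity_mass f (exhaust A n)) =
      emeasure (count_space UNIV) (\<Union>n. SIGMA w:exhaust A n. {..<f w})"
    unfolding multiplicity_mass_def using incseq_exhaust[of A]
    by (intro SUP_emeasure_incseq) (auto simp: incseq_def)
  ultimately show ?thesis
    using assms by (simp add: multiplicity_mass_def[of f A] multiplicity_mass_finite finite_exhaust)
qed

text \<open>A supremum is bounded by \<open>k\<close> iff all its terms are, so the event "mass at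
  most \<open>k\<close>" is a decreasing limit of events about finite sums. The event "mass equal to
  \<open>k\<close>" has no such monotone form, which is why probabilities are first computed for
  inequalities.\<close>

lemma multiplicity_mass_le_iff:
  assumes "countable A"
  shows "multiplicity_mass f A \<le> of_nat k \<longleftrightarrow> (\<forall>n. (\<Sum>w\<in>exhaust A n. f w) \<le> k)"
  unfolding multiplicity_mass_exhaust[OF assms] SUP_le_iff by (simp flip: of_nat_sum)

lemma borel_measurable_multiplicity_mass:
  assumes "countable A" "\<And>w. w \<in> A \<Longrightarrow> (\<lambda>x. f x w) \<in> measurable M (count_space UNIV)"
  shows "(\<lambda>x. multiplicity_mass (f x) A) \<in> borel_measurable M"
  unfolding multiplicity_mass_exhaust[OF assms(1)]
proof (rule borel_measurable_SUP)
  fix n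
  have "(\<lambda>x. \<Sum>w\<in>exhaust A n. f x w) \<in> measurable M (count_space UNIV)"
    using assms(2) exhaust_subset[of A n] by (intro measurable_sum_count_space_nat) auto
  then show "(\<lambda>x. of_nat (\<Sum>w\<in>exhaust A n. f x w) :: ennreal) \<in> borel_measurable M"
    by (rule measurable_compose) simp
qed simp

section \<open>Construction of the Poisson process on a countable space with atoms of finite
  intensity\<close>

locale discrete_intensity =
  fixes \<Lambda> :: "'w measure"
  assumes countable_space: "countable (space \<Lambda>)"
    and sets_Pow: "sets \<Lambda> = Pow (space \<Lambda>)"
    and finite_atom: "w \<in> space \<Lambda> \<Longrightarrow> emeasure \<Lambda> {w} < \<infinity>"
begin

sublocale product_prob_space "\<lambda>w. measure_pmf (poisson_law (measure \<Lambda> {w}))" "space \<Lambda>"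
  by unfold_locales

text \<open>Every atom independently receives a Poisson number of points whose rate is the mass of
  the atom. Superposition then gives the Poisson law on every set.\<close>

abbreviation poisson_field :: "('w \<Rightarrow> nat) measure" where
  "poisson_field \<equiv> \<Pi>\<^sub>M w\<in>space \<Lambda>. measure_pmf (poisson_law (measure \<Lambda> {w}))"

lemma countable_subset_space: "A \<subseteq> space \<Lambda> \<Longrightarrow> countable A"
  using countable_space countable_subset by blast

lemma component_measurable:
  assumes "w \<in> V"
  shows "(\<lambda>x. x w) \<in> measurable (\<Pi>\<^sub>M w\<in>V. measure_pmf (poisson_law (measure \<Lambda> {w}))) (count_space UNIV)"
  using measurable_component_singleton[OF assms, of "\<lambda>w. measure_pmf (poisson_law (measure \<Lambda> {w}))"]
  by (simp cong: measurable_cong_sets)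

lemma mass_measurable:
  assumes "A \<subseteq> V" "A \<subseteq> space \<Lambda>"
  shows "(\<lambda>x. multiplicity_mass x A) \<in>
    borel_measurable (\<Pi>\<^sub>M w\<in>V. measure_pmf (poisson_law (measure \<Lambda> {w})))"
  using assms by (intro borel_measurable_multiplicity_mass countable_subset_space component_measurable) auto

lemma finite_emeasure: "finite F \<Longrightarrow> F \<subseteq> space \<Lambda> \<Longrightarrow> emeasure \<Lambda> F < \<infinity>"
proof (induction F rule: finite_induct)
  case (insert w F)
  have "emeasure \<Lambda> (insert w F) \<le> emeasure \<Lambda> {w} + emeasure \<Lambda> F"
    using emeasure_subadditive[of "{w}" \<Lambda> F] insert sets_Pow by simp
  also have "\<dots> < \<infinity>" using insert finite_atom[of w] by simp
  finally show ?case .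
qed simp

text \<open>Induction on \<open>F\<close>: the multiplicity of a new atom depends on a coordinate
  outside \<open>F\<close>, hence is independent of the sum over \<open>F\<close>, and Poisson
  weights convolve.\<close>

lemma prob_sum_eq:
  assumes "finite F" "F \<subseteq> space \<Lambda>"
  shows "P.prob {x \<in> space poisson_field. (\<Sum>w\<in>F. x w) = k} = poisson_weight (measure \<Lambda> F) k"
  using assms
proof (induction F arbitrary: k rule: finite_induct)
  case empty
  then show ?case
    using P.prob_space by (cases k) (auto simp: poisson_weight_def)
next
  case (insert v F)
  let ?M = "\<lambda>w. measure_pmf (poisson_law (measure \<Lambda> {w}))"
  have "P.indep_var (count_space UNIV) ((\<lambda>x. x v) \<circ> (\<lambda>x. restrict x {v}))
      (count_space UNIV) ((\<lambda>x. \<Sum>w\<in>F. x w) \<circ> (\<lambda>x. restrict x F))"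
    using insert
    by (intro P.indep_var_compose[OF P.indep_var_restrict[OF indep_vars_component]]
        component_measurable measurable_sum_count_space_nat) auto
  moreover have "(\<lambda>x :: 'w \<Rightarrow> nat. x v) \<circ> (\<lambda>x. restrict x {v}) = (\<lambda>x. x v)" by auto
  moreover have "(\<lambda>x :: 'w \<Rightarrow> nat. \<Sum>w\<in>F. x w) \<circ> (\<lambda>x. restrict x F) = (\<lambda>x. \<Sum>w\<in>F. x w)" by auto
  ultimately have ind: "P.indep_var (count_space UNIV) (\<lambda>x. x v) (count_space UNIV) (\<lambda>x. \<Sum>w\<in>F. x w)"
    by (simp only:)
  have single: "P.prob {x \<in> space poisson_field. x v = i} = poisson_weight (measure \<Lambda> {v}) i" for i
    using insert emeasure_PiM_Collect_single[of v "{i}"]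
    by (simp add: measure_def[of poisson_field] emeasure_pmf_single pmf_poisson_law poisson_weight_def)
  have "measure \<Lambda> (insert v F) = measure \<Lambda> {v} + measure \<Lambda> F"
    using measure_Union[of \<Lambda> "{v}" F] insert finite_emeasure[of "{v}"] finite_emeasure[of F] sets_Pow
    by simp
  then show ?case
    using insert P.prob_sum_nat[OF ind] by (simp add: single poisson_weight_add)
qed

lemma prob_sum_le:
  assumes "finite F" "F \<subseteq> space \<Lambda>"
  shows "P.prob {x \<in> space poisson_field. (\<Sum>w\<in>F. x w) \<le> k} = (\<Sum>i\<le>k. poisson_weight (measure \<Lambda> F) i)"
proof -
  have [measurable]: "(\<lambda>x. \<Sum>w\<in>F. x w) \<in> measurable poisson_field (count_space UNIV)"
    using assms by (intro measurable_sum_count_space_nat component_measurable) auto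
  have "{x \<in> space poisson_field. (\<Sum>w\<in>F. x w) \<le> k} =
      (\<Union>i\<le>k. {x \<in> space poisson_field. (\<Sum>w\<in>F. x w) = i})"
    by auto
  also have "P.prob \<dots> = (\<Sum>i\<le>k. P.prob {x \<in> space poisson_field. (\<Sum>w\<in>F. x w) = i})"
    by (intro P.finite_measure_finite_Union) (auto simp: disjoint_family_on_def)
  finally show ?thesis using prob_sum_eq[OF assms] by simp
qed

text \<open>Continuity from above along the exhaustion. The statement makes no assumption on the
  mass of \<open>A\<close>, so it serves both the finite and the infinite case.\<close>

lemma prob_mass_le_tendsto:
  assumes A: "A \<subseteq> space \<Lambda>"
  shows "(\<lambda>n. \<Sum>i\<le>k. poisson_weight (measure \<Lambda> (exhaust A n)) i)
    \<longlonglongrightarrow> P.prob {x \<in> space poisson_field. multiplicity_mass x A \<le> of_nat k}"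
proof -
  let ?E = "\<lambda>n. {x \<in> space poisson_field. (\<Sum>w\<in>exhaust A n. x w) \<le> k}"
  have cA: "countable A" using A by (rule countable_subset_space)
  have fin: "finite (exhaust A n)" "exhaust A n \<subseteq> space \<Lambda>" for n
    using finite_exhaust[OF cA] exhaust_subset[of A n] A by auto
  have [measurable]: "(\<lambda>x. \<Sum>w\<in>exhaust A n. x w) \<in> measurable poisson_field (count_space UNIV)" for n
    using fin by (intro measurable_sum_count_space_nat component_measurable) auto
  have "(\<lambda>n. P.prob (?E n)) \<longlonglongrightarrow> P.prob (\<Inter>n. ?E n)"
  proof (rule P.finite_Lim_measure_decseq)
    show "decseq ?E"
    proof (rule decseq_SucI, safe)
      fix n x assume "(\<Sum>w\<in>exhaust A (Suc n). x w) \<le> k"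
      moreover have "(\<Sum>w\<in>exhaust A n. x w) \<le> (\<Sum>w\<in>exhaust A (Suc n). x w)" for x :: "'w \<Rightarrow> nat"
        using fin incseq_SucD[OF incseq_exhaust, of A n] by (intro sum_mono2) auto
      ultimately show "(\<Sum>w\<in>exhaust A n. x w) \<le> k" by (meson le_trans)
    qed
  qed auto
  also have "(\<Inter>n. ?E n) = {x \<in> space poisson_field. multiplicity_mass x A \<le> of_nat k}"
    by (auto simp: multiplicity_mass_le_iff[OF cA])
  finally show ?thesis by (simp add: prob_sum_le fin)
qed

lemma prob_mass_eq:
  assumes A: "A \<subseteq> space \<Lambda>" and finA: "emeasure \<Lambda> A < \<infinity>"
  shows "P.prob {x \<in> space poisson_field. multiplicity_mass x A = of_nat k} = poisson_weight (measure \<Lambda> A) k"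
proof -
  have [measurable]: "(\<lambda>x. multiplicity_mass x A) \<in> borel_measurable poisson_field"
    using A by (intro mass_measurable)
  have "(\<lambda>n. measure \<Lambda> (exhaust A n)) \<longlonglongrightarrow> measure \<Lambda> (\<Union>n. exhaust A n)"
    using A exhaust_subset[of A] finA sets_Pow incseq_exhaust[of A]
    by (intro Lim_measure_incseq) (auto simp: UN_exhaust)
  then have "(\<lambda>n. \<Sum>i\<le>k. poisson_weight (measure \<Lambda> (exhaust A n)) i)
      \<longlonglongrightarrow> (\<Sum>i\<le>k. poisson_weight (measure \<Lambda> A) i)" for k
    unfolding poisson_weight_def UN_exhaust by (intro tendsto_intros) auto
  from LIMSEQ_unique[OF prob_mass_le_tendsto[OF A] this]
  have le: "P.prob {x \<in> space poisson_field. multiplicity_mass x A \<le> of_nat k} =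
      (\<Sum>i\<le>k. poisson_weight (measure \<Lambda> A) i)" for k .
  show ?thesis
  proof (cases k)
    case 0
    then show ?thesis using le[of 0] by simp
  next
    case (Suc j)
    have "(of_nat m :: ennreal) \<le> of_nat l \<longleftrightarrow> m \<le> l" for m l by simp
    \<comment> \<open>Here \<open>j\<close> is the predecessor of \<open>k\<close>. A mass is a
      natural number or infinite, so no value lies strictly between \<open>j\<close> and
      \<open>k\<close>.\<close>
    then have "multiplicity_mass x A = of_nat k \<longleftrightarrow>
        multiplicity_mass x A \<le> of_nat k \<and> \<not> multiplicity_mass x A \<le> of_nat j" for x
      using multiplicity_mass_range[of x A] Suc by (auto simp: Nats_def top_unique simp del: of_nat_Suc)
    then have "{x \<in> space poisson_field. multiplicity_mass x A = of_nat k} =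
        {x \<in> space poisson_field. multiplicity_mass x A \<le> of_nat k} -
        {x \<in> space poisson_field. multiplicity_mass x A \<le> of_nat j}"
      by auto
    also have "P.prob \<dots> = (\<Sum>i\<le>k. poisson_weight (measure \<Lambda> A) i) - (\<Sum>i\<le>j. poisson_weight (measure \<Lambda> A) i)"
    proof (subst P.finite_measure_Diff)
      have "(of_nat j :: ennreal) \<le> of_nat k" using Suc by simp
      then show "{x \<in> space poisson_field. multiplicity_mass x A \<le> of_nat j} \<subseteq>
          {x \<in> space poisson_field. multiplicity_mass x A \<le> of_nat k}"
        by (auto intro: order_trans)
    qed (auto simp: le)
    finally show ?thesis using Suc by simp
  qed
qed

text \<open>The rates of the finite pieces tend to infinity while each Poisson weight vanishes at
  large rates. So every bound \<open>k\<close> on the mass has probability 0, and there are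
  countably many bounds.\<close>

lemma AE_mass_infinite:
  assumes A: "A \<subseteq> space \<Lambda>" and infA: "emeasure \<Lambda> A = \<infinity>"
  shows "AE x in poisson_field. multiplicity_mass x A = \<infinity>"
proof -
  have [measurable]: "(\<lambda>x. multiplicity_mass x A) \<in> borel_measurable poisson_field"
    using A by (intro mass_measurable)
  have fin: "emeasure \<Lambda> (exhaust A n) < \<infinity>" for n
    using finite_exhaust[OF countable_subset_space[OF A]] exhaust_subset[of A n] A
    by (intro finite_emeasure) auto
  have "(\<lambda>n. emeasure \<Lambda> (exhaust A n)) \<longlonglongrightarrow> emeasure \<Lambda> (\<Union>n. exhaust A n)"
    using A exhaust_subset[of A] sets_Pow incseq_exhaust[of A] by (intro Lim_emeasure_incseq) auto
  then have "(\<lambda>n. ennreal (measure \<Lambda> (exhaust A n))) \<longlonglongrightarrow> \<infinity>"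
    using fin infA by (simp add: UN_exhaust emeasure_eq_ennreal_measure less_top)
  then have "filterlim (\<lambda>n. measure \<Lambda> (exhaust A n)) at_top sequentially"
    by (simp add: ennreal_tendsto_top_eq_at_top)
  then have lim0: "(\<lambda>n. \<Sum>i\<le>k. poisson_weight (measure \<Lambda> (exhaust A n)) i) \<longlonglongrightarrow> (\<Sum>i\<le>k. 0)" for k
    by (intro tendsto_sum filterlim_compose[OF poisson_weight_tendsto_0])
  have "P.prob {x \<in> space poisson_field. multiplicity_mass x A \<le> of_nat k} = 0" for k
    using LIMSEQ_unique[OF prob_mass_le_tendsto[OF A] lim0[of k]] by simp
  then have "AE x in poisson_field. x \<notin> {x \<in> space poisson_field. multiplicity_mass x A \<le> of_nat k}" for k
    by (subst P.prob_eq_0[symmetric]) auto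
  then have "AE x in poisson_field. \<not> multiplicity_mass x A \<le> of_nat k" for k
    using AE_space by eventually_elim auto
  then have "AE x in poisson_field. \<forall>k. \<not> multiplicity_mass x A \<le> of_nat k"
    by (simp add: AE_all_countable)
  then show ?thesis
  proof eventually_elim
    case (elim x)
    then show ?case using multiplicity_mass_range[of x A] by (auto simp: Nats_def)
  qed
qed

text \<open>The mass of \<open>A i\<close> depends only on the coordinates in \<open>A i\<close>,
  and these blocks of coordinates are disjoint.\<close>

lemma mass_indep:
  assumes "A ` I \<subseteq> Pow (space \<Lambda>)" "disjoint_family_on A I"
  shows "P.indep_vars (\<lambda>_. borel) (\<lambda>i x. multiplicity_mass x (A i)) I"
proof -
  have "P.indep_vars (\<lambda>_. borel) (\<lambda>i x. multiplicity_mass (restrict (\<lambda>w. x w) (A i)) (A i)) I"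
    by (rule P.indep_vars_compose2[OF P.indep_vars_restrict[OF indep_vars_component _ assms(2)]])
      (use assms in \<open>auto intro!: mass_measurable\<close>)
  moreover have "multiplicity_mass (restrict (\<lambda>w. x w) (A i)) (A i) = multiplicity_mass x (A i)" for x i
    by (rule multiplicity_mass_cong) simp
  ultimately show ?thesis by simp
qed

lemma poisson_point_process_field:
  "poisson_point_process poisson_field (multiplicity_measure (space \<Lambda>)) \<Lambda>"
  unfolding poisson_point_process_def
proof (intro conjI ballI allI impI)
  show "prob_space poisson_field" by (rule P.prob_space_axioms)
  show "sets (multiplicity_measure (space \<Lambda>) x) = sets \<Lambda>" for x
    by (simp add: sets_Pow)
  show "emeasure (multiplicity_measure (space \<Lambda>) x) A \<in> insert \<infinity> \<nat>" if "A \<in> sets \<Lambda>" for x A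
    using that sets.sets_into_space[OF that] multiplicity_mass_range[of x A] by (simp add: emeasure_multiplicity_measure)
  show "(\<lambda>x. emeasure (multiplicity_measure (space \<Lambda>) x) A) \<in> borel_measurable poisson_field"
    if "A \<in> sets \<Lambda>" for A
    using mass_measurable[of A "space \<Lambda>"] sets.sets_into_space[OF that] by (simp add: emeasure_multiplicity_measure)
  show "P.prob {x \<in> space poisson_field. emeasure (multiplicity_measure (space \<Lambda>) x) A = of_nat k} =
      exp (- measure \<Lambda> A) * measure \<Lambda> A ^ k / fact k" if "A \<in> sets \<Lambda>" "emeasure \<Lambda> A < \<infinity>" for A k
    using prob_mass_eq[of A k] sets.sets_into_space[OF that(1)] that(2)
    by (simp add: emeasure_multiplicity_measure poisson_weight_def)
  show "AE x in poisson_field. emeasure (multiplicity_measure (space \<Lambda>) x) A = \<infinity>"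
    if "A \<in> sets \<Lambda>" "emeasure \<Lambda> A = \<infinity>" for A
    using AE_mass_infinite[of A] sets.sets_into_space[OF that(1)] that(2)
    by (simp add: emeasure_multiplicity_measure)
  show "P.indep_vars (\<lambda>_. borel) (\<lambda>i x. emeasure (multiplicity_measure (space \<Lambda>) x) (A i)) I"
    if "finite I" "A ` I \<subseteq> sets \<Lambda>" "disjoint_family_on A I" for I :: "nat set" and A
  proof -
    have "A i \<subseteq> space \<Lambda>" if "i \<in> I" for i
      using that \<open>A ` I \<subseteq> sets \<Lambda>\<close> sets_Pow by blast
    then have "P.indep_vars (\<lambda>_. borel) (\<lambda>i x. emeasure (multiplicity_measure (space \<Lambda>) x) (A i)) I \<longleftrightarrow>
        P.indep_vars (\<lambda>_. borel) (\<lambda>i x. multiplicity_mass x (A i)) I"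
      by (intro P.indep_vars_cong refl ext emeasure_multiplicity_measure)
    then show ?thesis using mass_indep[of A I] that sets_Pow by simp
  qed
qed

end

section \<open>Clauses of the definition of a Poisson process, and change of its sample
  space\<close>

lemma
  assumes "poisson_point_process M \<eta> \<Lambda>"
  shows ppp_prob_space: "prob_space M"
    and ppp_sets: "m \<in> space M \<Longrightarrow> sets (\<eta> m) = sets \<Lambda>"
    and ppp_range: "m \<in> space M \<Longrightarrow> A \<in> sets \<Lambda> \<Longrightarrow> emeasure (\<eta> m) A \<in> insert \<infinity> \<nat>"
    and ppp_measurable: "A \<in> sets \<Lambda> \<Longrightarrow> (\<lambda>m. emeasure (\<eta> m) A) \<in> borel_measurable M"
    and ppp_prob: "A \<in> sets \<Lambda> \<Longrightarrow> emeasure \<Lambda> A < \<infinity> \<Longrightarrow>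
      measure M {m \<in> space M. emeasure (\<eta> m) A = of_nat k} = exp (- measure \<Lambda> A) * measure \<Lambda> A ^ k / fact k"
    and ppp_AE_infinite: "A \<in> sets \<Lambda> \<Longrightarrow> emeasure \<Lambda> A = \<infinity> \<Longrightarrow> AE m in M. emeasure (\<eta> m) A = \<infinity>"
    and ppp_indep: "finite (I :: nat set) \<Longrightarrow> B ` I \<subseteq> sets \<Lambda> \<Longrightarrow> disjoint_family_on B I \<Longrightarrow>
      prob_space.indep_vars M (\<lambda>_. borel) (\<lambda>i m. emeasure (\<eta> m) (B i)) I"
proof -
  note ppp = assms[unfolded poisson_point_process_def]
  show "prob_space M" by (rule ppp[THEN conjunct1])
  note ppp = ppp[THEN conjunct2]
  show "m \<in> space M \<Longrightarrow> sets (\<eta> m) = sets \<Lambda>"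
    and "m \<in> space M \<Longrightarrow> A \<in> sets \<Lambda> \<Longrightarrow> emeasure (\<eta> m) A \<in> insert \<infinity> \<nat>"
    using ppp[THEN conjunct1] by blast+
  note ppp = ppp[THEN conjunct2]
  show "A \<in> sets \<Lambda> \<Longrightarrow> (\<lambda>m. emeasure (\<eta> m) A) \<in> borel_measurable M"
    using ppp[THEN conjunct1] by (rule bspec)
  note ppp = ppp[THEN conjunct2]
  show "A \<in> sets \<Lambda> \<Longrightarrow> emeasure \<Lambda> A < \<infinity> \<Longrightarrow>
      measure M {m \<in> space M. emeasure (\<eta> m) A = of_nat k} = exp (- measure \<Lambda> A) * measure \<Lambda> A ^ k / fact k"
    by (rule ppp[THEN conjunct1, rule_format])
  note ppp = ppp[THEN conjunct2]
  show "A \<in> sets \<Lambda> \<Longrightarrow> emeasure \<Lambda> A = \<infinity> \<Longrightarrow> AE m in M. emeasure (\<eta> m) A = \<infinity>"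
    by (rule ppp[THEN conjunct1, rule_format])
  note ppp = ppp[THEN conjunct2]
  show "finite (I :: nat set) \<Longrightarrow> B ` I \<subseteq> sets \<Lambda> \<Longrightarrow> disjoint_family_on B I \<Longrightarrow>
      prob_space.indep_vars M (\<lambda>_. borel) (\<lambda>i m. emeasure (\<eta> m) (B i)) I"
    by (rule ppp[rule_format])
qed

text \<open>The sample points of \<open>M\<close> are renamed by \<open>H\<close>, which is
  injective on \<open>space M\<close> with left inverse \<open>f\<close>. The new sigma-algebra is
  pulled back along \<open>f\<close>, so measurability passes through \<open>f\<close>; since
  \<open>f n\<close> always lies in \<open>space M\<close>, the process is defined at every new
  sample point.\<close>

lemma poisson_point_process_transport:
  assumes ppp: "poisson_point_process M \<eta> \<Lambda>"
    and H: "\<And>m. m \<in> space M \<Longrightarrow> f (H m) = m" and f: "\<And>n. f n \<in> space M"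
  shows "poisson_point_process (distr M (vimage_algebra UNIV f M) H) (\<lambda>n. \<eta> (f n)) \<Lambda>"
proof -
  interpret prob_space M using ppp by (rule ppp_prob_space)
  let ?N = "vimage_algebra UNIV f M"
  have f_meas: "f \<in> measurable ?N M"
    using f by (intro measurable_vimage_algebra1) auto
  have H_meas: "H \<in> measurable M ?N"
  proof (rule measurable_vimage_algebra2)
    show "(\<lambda>m. f (H m)) \<in> measurable M M"
      using measurable_cong[of M "\<lambda>m. f (H m)" "\<lambda>m. m" M] H by simp
  qed simp
  have meas: "(\<lambda>n. emeasure (\<eta> (f n)) A) \<in> borel_measurable ?N" if "A \<in> sets \<Lambda>" for A
    using measurable_compose[OF f_meas ppp_measurable[OF ppp that]] .
  show ?thesis
    unfolding poisson_point_process_def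
  proof (intro conjI ballI allI impI)
    show "prob_space (distr M ?N H)" using H_meas by (rule prob_space_distr)
    show "sets (\<eta> (f n)) = sets \<Lambda>" for n
      by (rule ppp_sets[OF ppp f])
    show "emeasure (\<eta> (f n)) A \<in> insert \<infinity> \<nat>" if "A \<in> sets \<Lambda>" for n A
      by (rule ppp_range[OF ppp f that])
    show "(\<lambda>n. emeasure (\<eta> (f n)) A) \<in> borel_measurable (distr M ?N H)" if "A \<in> sets \<Lambda>" for A
      using meas[OF that] by simp
    show "measure (distr M ?N H) {n \<in> space (distr M ?N H). emeasure (\<eta> (f n)) A = of_nat k} =
        exp (- measure \<Lambda> A) * measure \<Lambda> A ^ k / fact k"
      if A: "A \<in> sets \<Lambda>" "emeasure \<Lambda> A < \<infinity>" for A and k :: nat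
    proof -
      have [measurable]: "(\<lambda>n. emeasure (\<eta> (f n)) A) \<in> borel_measurable ?N" using A by (intro meas)
      let ?E = "{n \<in> space ?N. emeasure (\<eta> (f n)) A = of_nat k}"
      have "?E \<in> sets ?N" by measurable
      with H_meas have "measure (distr M ?N H) ?E = prob (H -` ?E \<inter> space M)"
        by (rule measure_distr)
      also have "H -` ?E \<inter> space M = {m \<in> space M. emeasure (\<eta> m) A = of_nat k}"
        using H by auto
      finally show ?thesis using ppp_prob[OF ppp A] by simp
    qed
    show "AE n in distr M ?N H. emeasure (\<eta> (f n)) A = \<infinity>"
      if A: "A \<in> sets \<Lambda>" "emeasure \<Lambda> A = \<infinity>" for A
    proof -
      have [measurable]: "(\<lambda>n. emeasure (\<eta> (f n)) A) \<in> borel_measurable ?N" using A by (intro meas)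
      have "AE m in M. emeasure (\<eta> m) A = \<infinity>" by (rule ppp_AE_infinite[OF ppp A])
      then have "AE m in M. emeasure (\<eta> (f (H m))) A = \<infinity>"
        using AE_space by eventually_elim (simp add: H)
      moreover have "{n \<in> space ?N. emeasure (\<eta> (f n)) A = \<infinity>} \<in> sets ?N" by measurable
      ultimately show ?thesis using AE_distr_iff[OF H_meas] by simp
    qed
    show "prob_space.indep_vars (distr M ?N H) (\<lambda>_. borel) (\<lambda>i n. emeasure (\<eta> (f n)) (A i)) I"
      if I: "finite I" "A ` I \<subseteq> sets \<Lambda>" "disjoint_family_on A I" for I :: "nat set" and A
    proof (rule indep_vars_distr[OF H_meas])
      show "(\<lambda>n. emeasure (\<eta> (f n)) (A i)) \<in> borel_measurable ?N" if "i \<in> I" for i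
      proof (rule meas)
        show "A i \<in> sets \<Lambda>" using I(2) that by blast
      qed
      have "indep_vars (\<lambda>_. borel) (\<lambda>i m. emeasure (\<eta> m) (A i)) I"
        by (rule ppp_indep[OF ppp I])
      then show "indep_vars (\<lambda>_. borel) (\<lambda>i m. emeasure (\<eta> (f (H m))) (A i)) I"
        by (subst indep_vars_cong_space[of _ _ "\<lambda>i m. emeasure (\<eta> m) (A i)"]) (simp_all add: H)
    qed
  qed
qed

text \<open>The canonical sample space: a multiplicity function is recovered from the masses of atoms.\<close>

lemma (in discrete_intensity) poisson_point_process_canonical:
  "\<exists>(M :: 'w measure measure) \<eta>. poisson_point_process M \<eta> \<Lambda>"
proof -
  \<comment> \<open>On measures whose atoms are not integers \<open>SOME\<close> picks arbitrary
    values. This is harmless: any natural-valued function extensional on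
    \<open>space \<Lambda>\<close> is a point of the product space.\<close>
  define f where "f N = (\<lambda>w\<in>space \<Lambda>. SOME k :: nat. emeasure N {w} = of_nat k)" for N :: "'w measure"
  have fm: "f (multiplicity_measure (space \<Lambda>) x) = x" if "x \<in> space poisson_field" for x
  proof
    fix w
    show "f (multiplicity_measure (space \<Lambda>) x) w = x w"
      using that
      by (cases "w \<in> space \<Lambda>")
        (auto simp: f_def emeasure_multiplicity_measure multiplicity_mass_finite space_PiM PiE_def extensional_def)
  qed
  have "f N \<in> space poisson_field" for N
    by (auto simp: f_def space_PiM)
  from poisson_point_process_transport[OF poisson_point_process_field fm this]
  show ?thesis by (intro exI)
qed

section \<open>Edge configurations\<close>

lemma space_edge_configs [simp]: "space (edge_configs E) = Pow E"
  by (simp add: edge_configs_def space_measure_of_conv)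

lemma sets_edge_configs:
  "sets (edge_configs E) = sigma_sets (Pow E) ((\<lambda>e. {\<omega> \<in> Pow E. e \<in> \<omega>}) ` E)"
  unfolding edge_configs_def by (rule sets_measure_of) auto

lemma edge_open_sets: "e \<in> E \<Longrightarrow> {\<omega> \<in> Pow E. e \<in> \<omega>} \<in> sets (edge_configs E)"
  unfolding sets_edge_configs by (intro sigma_sets.Basic imageI)

lemma measurable_edge_configsI:
  assumes "\<And>m. m \<in> space M \<Longrightarrow> U m \<subseteq> E" "\<And>e. e \<in> E \<Longrightarrow> {m \<in> space M. e \<in> U m} \<in> sets M"
  shows "U \<in> measurable M (edge_configs E)"
  unfolding edge_configs_def
proof (rule measurable_measure_of)
  show "U \<in> space M \<rightarrow> Pow E" using assms(1) by auto
  fix A assume "A \<in> (\<lambda>e. {\<omega> \<in> Pow E. e \<in> \<omega>}) ` E"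
  then obtain e where e: "e \<in> E" "A = {\<omega> \<in> Pow E. e \<in> \<omega>}" by blast
  then have "U -` A \<inter> space M = {m \<in> space M. e \<in> U m}" using assms(1) by auto
  then show "U -` A \<inter> space M \<in> sets M" using assms(2) e by simp
qed auto

text \<open>The events that all edges of a finite \<open>K\<close> are open form a generating system
  closed under intersection: intersecting takes the union of the edge sets. The case
  \<open>K = {}\<close> gives the whole space.\<close>

lemma edge_configs_measure_eqI:
  assumes P: "prob_space P" "sets P = sets (edge_configs E)"
    and Q: "sets Q = sets (edge_configs E)"
    and eq: "\<And>K. finite K \<Longrightarrow> K \<subseteq> E \<Longrightarrow> emeasure P {\<omega> \<in> Pow E. K \<subseteq> \<omega>} = emeasure Q {\<omega> \<in> Pow E. K \<subseteq> \<omega>}"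
  shows "P = Q"
proof -
  define C where "C = (\<lambda>K. {\<omega> \<in> Pow E. K \<subseteq> \<omega>}) ` {K. finite K \<and> K \<subseteq> E}"
  have CE: "C \<subseteq> Pow (Pow E)" by (auto simp: C_def)
  have "C \<subseteq> sets (edge_configs E)"
  proof
    fix A assume "A \<in> C"
    then obtain K where K: "finite K" "K \<subseteq> E" "A = {\<omega> \<in> Pow E. K \<subseteq> \<omega>}" by (auto simp: C_def)
    have "{\<omega> \<in> space (edge_configs E). \<forall>e\<in>K. e \<in> \<omega>} \<in> sets (edge_configs E)"
      using K edge_open_sets[of _ E] by (intro sets.sets_Collect_finite_All) (simp_all add: subset_iff)
    also have "{\<omega> \<in> space (edge_configs E). \<forall>e\<in>K. e \<in> \<omega>} = A" using K by auto
    finally show "A \<in> sets (edge_configs E)" .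
  qed
  then have "sigma_sets (Pow E) C \<subseteq> sets (edge_configs E)"
    using sets.sigma_sets_subset[of C "edge_configs E"] by simp
  moreover have "sets (edge_configs E) \<subseteq> sigma_sets (Pow E) C"
    unfolding sets_edge_configs
  proof (rule sigma_sets_mono)
    show "(\<lambda>e. {\<omega> \<in> Pow E. e \<in> \<omega>}) ` E \<subseteq> sigma_sets (Pow E) C"
    proof safe
      fix e assume "e \<in> E"
      then have "{\<omega> \<in> Pow E. {e} \<subseteq> \<omega>} \<in> C" unfolding C_def by (intro imageI) simp
      then show "{\<omega> \<in> Pow E. e \<in> \<omega>} \<in> sigma_sets (Pow E) C" by (auto intro: sigma_sets.Basic)
    qed
  qed
  ultimately have sets_C: "sets (edge_configs E) = sigma_sets (Pow E) C" by (rule antisym[rotated])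
  have stable: "Int_stable C"
  proof (rule Int_stableI)
    fix A B assume "A \<in> C" "B \<in> C"
    then obtain K L where "finite K" "K \<subseteq> E" "A = {\<omega> \<in> Pow E. K \<subseteq> \<omega>}"
      "finite L" "L \<subseteq> E" "B = {\<omega> \<in> Pow E. L \<subseteq> \<omega>}" by (auto simp: C_def)
    then show "A \<inter> B \<in> C" unfolding C_def by (intro image_eqI[of _ _ "K \<union> L"]) auto
  qed
  have top: "Pow E \<in> C" unfolding C_def by (rule image_eqI[of _ _ "{}"]) auto
  show "P = Q"
  proof (rule measure_eqI_generator_eq[OF stable CE])
    show "emeasure P A = emeasure Q A" if "A \<in> C" for A using that eq by (auto simp: C_def)
    show "sets P = sigma_sets (Pow E) C" "sets Q = sigma_sets (Pow E) C" using P Q sets_C by auto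
    show "range (\<lambda>_ :: nat. Pow E) \<subseteq> C" using top by auto
    show "(\<Union>i :: nat. Pow E) = Pow E" by simp
    show "emeasure P (Pow E) \<noteq> \<infinity>" for i :: nat
      using prob_space.finite_measure[OF P(1)] by (simp add: finite_measure.emeasure_finite)
  qed
qed

lemma emeasure_count_space_bij_betw:
  assumes "bij_betw f A B"
  shows "emeasure (count_space UNIV) A = emeasure (count_space UNIV) B"
  using bij_betw_finite[OF assms] bij_betw_same_card[OF assms] by (simp add: emeasure_count_space)

text \<open>The translations are restricted to the carrier because elements of
  \<open>BijGroup\<close> must be extensional.\<close>

lemma group_action_left_mult:
  fixes G (structure)
  assumes "group G"
  shows "group_action G (carrier G) (\<lambda>g. \<lambda>x\<in>carrier G. g \<otimes> x)"
proof -
  interpret group G by fact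
  have bij: "(\<lambda>x\<in>carrier G. g \<otimes> x) \<in> Bij (carrier G)" if "g \<in> carrier G" for g
  proof -
    have "bij_betw (\<lambda>x. g \<otimes> x) (carrier G) (carrier G)"
      using that by (intro bij_betwI[of _ _ _ "\<lambda>x. inv g \<otimes> x"]) (auto simp: m_assoc[symmetric])
    then show ?thesis by (simp add: Bij_def cong: bij_betw_cong)
  qed
  show ?thesis
    unfolding group_action_def group_hom_def group_hom_axioms_def
  proof (intro conjI homI)
    show "group G" by fact
    show "group (BijGroup (carrier G))" by (rule group_BijGroup)
    show "(\<lambda>x\<in>carrier G. g \<otimes> x) \<in> carrier (BijGroup (carrier G))" if "g \<in> carrier G" for g
      using bij[OF that] by (simp add: BijGroup_def)
    show "(\<lambda>x\<in>carrier G. g \<otimes> h \<otimes> x) = (\<lambda>x\<in>carrier G. g \<otimes> x) \<otimes>\<^bsub>BijGroup (carrier G)\<^esub> (\<lambda>x\<in>carrier G. h \<otimes> x)"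
      if "g \<in> carrier G" "h \<in> carrier G" for g h
      using that bij by (auto simp: BijGroup_def compose_def m_assoc)
  qed
qed

section \<open>Walls from Folner sets\<close>

locale folner_walls = group G for G (structure) +
  fixes F :: "nat \<Rightarrow> 'a set"
  assumes infinite_carrier: "infinite (carrier G)"
    and countable_carrier: "countable (carrier G)"
    and finite_F: "finite (F n)"
    and F_nonempty: "F n \<noteq> {}"
    and F_subset: "F n \<subseteq> carrier G"
    and folner: "g \<in> carrier G \<Longrightarrow> \<exists>C. \<forall>n. real (card ((g <# F n) - F n)) \<le> C * (1 / 2) ^ n * card (F n)"
begin

section \<open>Tiles, their walls and the wall measure\<close>

definition tile :: "nat \<Rightarrow> 'a \<Rightarrow> 'a set" where
  "tile n g = {x \<in> carrier G. inv x \<otimes> g \<in> F n}"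

text \<open>The tile is the translate of the inverse of \<open>F n\<close> by \<open>g\<close>, and
  it is the finite side of this wall. A point \<open>x\<close> lies in it iff \<open>g\<close>
  belongs to \<open>x <# F n\<close>, which turns counting tiles into counting elements of
  translates of \<open>F n\<close>.\<close>

definition tile_wall :: "nat \<Rightarrow> 'a \<Rightarrow> 'a set set" where
  "tile_wall n g = {tile n g, carrier G - tile n g}"

definition tile_walls :: "'a set set set" where
  "tile_walls = (\<lambda>(n, g). tile_wall n g) ` (UNIV \<times> carrier G)"

text \<open>The weights live on the indices \<open>(n, g)\<close> and are pushed forward, so
  different indices with the same wall add their weights.\<close>

definition wall_measure :: "'a set set measure" where
  "wall_measure = distr (density (count_space (UNIV \<times> carrier G)) (\<lambda>(n, g). ennreal (1 / card (F n))))
     (count_space tile_walls) (\<lambda>(n, g). tile_wall n g)"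

definition translate :: "'a \<Rightarrow> 'a \<Rightarrow> 'a" where
  "translate g = (\<lambda>x\<in>carrier G. g \<otimes> x)"

abbreviation translate_wall :: "'a \<Rightarrow> 'a set set \<Rightarrow> 'a set set" where
  "translate_wall g W \<equiv> (\<lambda>B. translate g ` B) ` W"

lemma translate_apply [simp]: "x \<in> carrier G \<Longrightarrow> translate g x = g \<otimes> x"
  by (simp add: translate_def)

lemma space_wall_measure [simp]: "space wall_measure = tile_walls"
  and sets_wall_measure [simp]: "sets wall_measure = Pow tile_walls"
  by (simp_all add: wall_measure_def)

lemma tile_subset: "tile n g \<subseteq> carrier G"
  by (auto simp: tile_def)

lemma tile_mult:
  assumes "h \<in> carrier G" "x \<in> carrier G" "g \<in> carrier G"
  shows "h \<otimes> x \<in> tile n (h \<otimes> g) \<longleftrightarrow> x \<in> tile n g"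
proof -
  have "inv h \<otimes> (h \<otimes> g) = g"
    using assms by (simp add: m_assoc[symmetric])
  then have "inv (h \<otimes> x) \<otimes> (h \<otimes> g) = inv x \<otimes> g"
    using assms by (simp add: inv_mult_group m_assoc)
  then show ?thesis using assms by (simp add: tile_def)
qed

lemma translate_image:
  assumes "h \<in> carrier G" "g \<in> carrier G"
  shows "translate h ` tile n g = tile n (h \<otimes> g)"
    and "translate h ` (carrier G - tile n g) = carrier G - tile n (h \<otimes> g)"
proof -
  have *: "y = translate h (inv h \<otimes> y)" "inv h \<otimes> y \<in> carrier G" if "y \<in> carrier G" for y
    using that assms by (auto simp: m_assoc[symmetric])
  have m: "inv h \<otimes> y \<in> tile n g \<longleftrightarrow> y \<in> tile n (h \<otimes> g)" if "y \<in> carrier G" for y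
    using that tile_mult[of h "inv h \<otimes> y" g n] assms by (simp add: m_assoc[symmetric])
  show "translate h ` tile n g = tile n (h \<otimes> g)"
  proof (intro equalityI subsetI)
    fix y assume "y \<in> translate h ` tile n g"
    then obtain x where x: "x \<in> tile n g" "y = translate h x" by blast
    then have "x \<in> carrier G" using tile_subset by blast
    then show "y \<in> tile n (h \<otimes> g)" using x assms tile_mult by simp
  next
    fix y assume y: "y \<in> tile n (h \<otimes> g)"
    then have "y \<in> carrier G" using tile_subset by blast
    then show "y \<in> translate h ` tile n g" using *[of y] m[of y] y by (intro image_eqI) auto
  qed
  show "translate h ` (carrier G - tile n g) = carrier G - tile n (h \<otimes> g)"
  proof (intro equalityI subsetI)
    fix y assume "y \<in> translate h ` (carrier G - tile n g)"
    then show "y \<in> carrier G - tile n (h \<otimes> g)" using assms tile_mult by auto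
  next
    fix y assume y: "y \<in> carrier G - tile n (h \<otimes> g)"
    then show "y \<in> translate h ` (carrier G - tile n g)" using *[of y] m[of y] by (intro image_eqI) auto
  qed
qed

lemma translate_tile_wall:
  assumes "h \<in> carrier G" "g \<in> carrier G"
  shows "translate_wall h (tile_wall n g) = tile_wall n (h \<otimes> g)"
  using translate_image[OF assms] by (simp add: tile_wall_def)

lemma tile_eq_image:
  assumes "g \<in> carrier G"
  shows "tile n g = (\<lambda>f. g \<otimes> inv f) ` F n"
proof (intro equalityI subsetI)
  fix x assume x: "x \<in> tile n g"
  then have "x = g \<otimes> inv (inv x \<otimes> g)"
    using assms by (auto simp: tile_def inv_mult_group m_assoc[symmetric])
  then show "x \<in> (\<lambda>f. g \<otimes> inv f) ` F n" using x by (auto simp: tile_def)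
next
  fix x assume "x \<in> (\<lambda>f. g \<otimes> inv f) ` F n"
  then obtain f where f: "f \<in> F n" "f \<in> carrier G" "x = g \<otimes> inv f" using F_subset by blast
  then have "inv x \<otimes> g = f" using assms by (simp add: inv_mult_group m_assoc)
  then show "x \<in> tile n g" using f assms by (simp add: tile_def)
qed

lemma finite_tile: "g \<in> carrier G \<Longrightarrow> finite (tile n g)"
  using finite_F by (simp add: tile_eq_image)

lemma tile_nonempty: "g \<in> carrier G \<Longrightarrow> tile n g \<noteq> {}"
  using F_nonempty by (simp add: tile_eq_image)

lemma tile_compl_nonempty: "g \<in> carrier G \<Longrightarrow> carrier G - tile n g \<noteq> {}"
  using infinite_carrier finite_tile[of g n] by (metis Diff_eq_empty_iff finite_subset)

lemma wall_tile_wall: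
  assumes "g \<in> carrier G"
  shows "wall (carrier G) (tile_wall n g)"
proof -
  have ne: "tile n g \<noteq> {}" "carrier G - tile n g \<noteq> {}"
    using tile_nonempty tile_compl_nonempty assms by auto
  have "partition_on (carrier G) (tile_wall n g)"
    using ne tile_subset by (auto simp: tile_wall_def partition_on_def disjoint_def)
  moreover have "tile n g \<noteq> carrier G - tile n g" using ne by blast
  ultimately show ?thesis by (simp add: wall_def tile_wall_def)
qed

lemma separates_tile_wall:
  assumes "x \<in> carrier G" "y \<in> carrier G"
  shows "separates (tile_wall n g) x y \<longleftrightarrow> (x \<in> tile n g \<longleftrightarrow> y \<notin> tile n g)"
  using assms by (auto simp: separates_def tile_wall_def)

text \<open>Tonelli on the index pairs. All mass computations for walls reduce to counting the
  indices \<open>g\<close> at each level \<open>n\<close>.\<close>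

lemma emeasure_wall_measure:
  assumes "A \<subseteq> tile_walls"
  shows "emeasure wall_measure A =
    (\<Sum>n. ennreal (1 / card (F n)) * emeasure (count_space UNIV) {g \<in> carrier G. tile_wall n g \<in> A})"
proof -
  let ?c = "\<lambda>n. ennreal (1 / card (F n))"
  let ?B = "(\<lambda>(n, g). tile_wall n g) -` A \<inter> (UNIV \<times> carrier G)"
  let ?D = "\<lambda>n. {g \<in> carrier G. tile_wall n g \<in> A}"
  have "emeasure wall_measure A = emeasure (density (count_space (UNIV \<times> carrier G)) (\<lambda>(n, g). ?c n)) ?B"
    unfolding wall_measure_def using assms by (subst emeasure_distr) (auto simp: tile_walls_def)
  also have "\<dots> = (\<integral>\<^sup>+p. (case p of (n, g) \<Rightarrow> ?c n) * indicator ?B p \<partial>count_space (UNIV \<times> carrier G))"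
    by (subst emeasure_density) auto
  also have "\<dots> = (\<integral>\<^sup>+p. (case p of (n, g) \<Rightarrow> ?c n) * indicator ?B p * indicator (UNIV \<times> carrier G) p \<partial>count_space UNIV)"
    by (rule nn_integral_count_space_indicator) simp
  also have "\<dots> = (\<integral>\<^sup>+p. ?c (fst p) * indicator (?D (fst p)) (snd p) \<partial>count_space UNIV)"
    by (intro nn_integral_cong) (auto simp: indicator_def split: prod.splits)
  also have "\<dots> = (\<integral>\<^sup>+n. \<integral>\<^sup>+g. ?c n * indicator (?D n) g \<partial>count_space UNIV \<partial>count_space UNIV)"
    using nn_integral_fst_count_space[of "\<lambda>p. ?c (fst p) * indicator (?D (fst p)) (snd p)"] by simp
  also have "\<dots> = (\<integral>\<^sup>+n. ?c n * emeasure (count_space UNIV) (?D n) \<partial>count_space UNIV)"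
    by (intro nn_integral_cong) (simp add: nn_integral_cmult)
  also have "\<dots> = (\<Sum>n. ?c n * emeasure (count_space UNIV) (?D n))"
    by (rule nn_integral_count_space_nat)
  finally show ?thesis .
qed

lemma card_F_pos: "0 < card (F n)"
  using finite_F F_nonempty by (simp add: card_gt_0_iff)

text \<open>The indices counted on the left are the elements of \<open>x <# F n\<close> outside
  \<open>y <# F n\<close>; left multiplication by \<open>inv y\<close> carries them injectively into
  the set on the right.\<close>

lemma card_split_le:
  assumes "x \<in> carrier G" "y \<in> carrier G"
  shows "emeasure (count_space UNIV) {g \<in> carrier G. x \<in> tile n g \<and> y \<notin> tile n g}
    \<le> ennreal (card (((inv y \<otimes> x) <# F n) - F n))"
proof -
  let ?A = "{g \<in> carrier G. x \<in> tile n g \<and> y \<notin> tile n g}"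
  let ?B = "((inv y \<otimes> x) <# F n) - F n"
  have fin: "finite ?B" using finite_F by (auto simp: l_coset_def)
  have sub: "(\<lambda>g. inv y \<otimes> g) ` ?A \<subseteq> ?B"
  proof safe
    fix g assume g: "g \<in> carrier G" "x \<in> tile n g" "y \<notin> tile n g"
    have "inv y \<otimes> g = inv y \<otimes> x \<otimes> (inv x \<otimes> g)"
      using assms g by (simp add: m_assoc) (simp add: m_assoc[symmetric])
    then show "inv y \<otimes> g \<in> (inv y \<otimes> x) <# F n" using g by (auto simp: l_coset_def tile_def)
    assume "inv y \<otimes> g \<in> F n"
    then show False using g assms by (simp add: tile_def)
  qed
  have inj: "inj_on (\<lambda>g. inv y \<otimes> g) ?A" using assms by (auto simp: inj_on_def)
  have "finite ?A" "card ?A \<le> card ?B"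
    using inj_on_finite[OF inj sub fin] card_inj_on_le[OF inj sub fin] by auto
  then show ?thesis by (simp add: emeasure_count_space_finite ennreal_of_nat_eq_real_of_nat)
qed

text \<open>A separating wall has exactly one of \<open>x\<close> and \<open>y\<close> in its tile.
  Either case contributes at level \<open>n\<close> at most a constant times
  \<open>(1 / 2) ^ n\<close>, by the Folner bound, and the geometric series converges.\<close>

lemma emeasure_walls_between:
  assumes x: "x \<in> carrier G" and y: "y \<in> carrier G"
  shows "emeasure wall_measure (walls_between wall_measure x y) < \<infinity>"
proof -
  obtain C where C: "\<And>n. real (card (((inv y \<otimes> x) <# F n) - F n)) \<le> C * (1 / 2) ^ n * card (F n)"
    using folner[of "inv y \<otimes> x"] x y by auto
  obtain D where D: "\<And>n. real (card (((inv x \<otimes> y) <# F n) - F n)) \<le> D * (1 / 2) ^ n * card (F n)"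
    using folner[of "inv x \<otimes> y"] x y by auto
  \<comment> \<open>The bound at \<open>n = 0\<close> forces the constants to be nonnegative, as the
    arithmetic in \<open>ennreal\<close> requires.\<close>
  have "0 \<le> C * card (F 0)" "0 \<le> D * card (F 0)"
    using order_trans[OF of_nat_0_le_iff C[of 0]] order_trans[OF of_nat_0_le_iff D[of 0]] by simp_all
  then have CD: "0 \<le> C" "0 \<le> D"
    using card_F_pos[of 0] by (simp_all add: zero_le_mult_iff)
  let ?W = "walls_between wall_measure x y"
  have bd: "ennreal (1 / card (F n)) * emeasure (count_space UNIV) {g \<in> carrier G. tile_wall n g \<in> ?W}
      \<le> ennreal ((C + D) * (1 / 2) ^ n)" for n
  proof -
    let ?P = "{g \<in> carrier G. x \<in> tile n g \<and> y \<notin> tile n g}" and ?Q = "{g \<in> carrier G. y \<in> tile n g \<and> x \<notin> tile n g}"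
    have "{g \<in> carrier G. tile_wall n g \<in> ?W} \<subseteq> ?P \<union> ?Q"
      using separates_tile_wall[OF x y] by (auto simp: walls_between_def)
    then have "emeasure (count_space UNIV) {g \<in> carrier G. tile_wall n g \<in> ?W}
        \<le> emeasure (count_space UNIV) (?P \<union> ?Q)" by (intro emeasure_mono) auto
    also have "\<dots> \<le> emeasure (count_space UNIV) ?P + emeasure (count_space UNIV) ?Q"
      by (intro emeasure_subadditive) auto
    also have "\<dots> \<le> ennreal (C * (1 / 2) ^ n * card (F n)) + ennreal (D * (1 / 2) ^ n * card (F n))"
      using card_split_le[OF x y, of n] card_split_le[OF y x, of n] C[of n] D[of n]
      by (intro add_mono) (auto intro: order_trans ennreal_leI)
    also have "\<dots> = ennreal ((C + D) * (1 / 2) ^ n * card (F n))"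
      using CD by (simp add: ennreal_plus[symmetric] algebra_simps del: ennreal_plus)
    finally have "ennreal (1 / card (F n)) * emeasure (count_space UNIV) {g \<in> carrier G. tile_wall n g \<in> ?W}
        \<le> ennreal (1 / card (F n)) * ennreal ((C + D) * (1 / 2) ^ n * card (F n))"
      by (rule mult_left_mono) simp
    also have "\<dots> = ennreal (1 / card (F n) * ((C + D) * (1 / 2) ^ n * card (F n)))"
      using CD by (intro ennreal_mult[symmetric]) auto
    also have "1 / card (F n) * ((C + D) * (1 / 2) ^ n * card (F n)) = (C + D) * (1 / 2) ^ n"
      using card_F_pos[of n] by simp
    finally show ?thesis .
  qed
  have W: "?W \<subseteq> tile_walls" by (auto simp: walls_between_def)
  have "emeasure wall_measure ?W \<le> (\<Sum>n. ennreal ((C + D) * (1 / 2) ^ n))"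
    unfolding emeasure_wall_measure[OF W]
    by (intro suminf_le bd summableI)
  also have "\<dots> < \<infinity>"
  proof -
    have "(\<Sum>n. ennreal ((C + D) * (1 / 2) ^ n)) \<noteq> \<infinity>"
      unfolding infinity_ennreal_def
      using CD by (intro ennreal_suminf_neq_top summable_mult summable_geometric) auto
    then show ?thesis by (simp add: less_top)
  qed
  finally show ?thesis .
qed

definition walls_around :: "'a \<Rightarrow> 'a set set set" where
  "walls_around v = {tile_wall n g | n g. g \<in> carrier G \<and> v \<in> tile n g}"

lemma walls_around_subset: "walls_around v \<subseteq> tile_walls"
  by (auto simp: walls_around_def tile_walls_def)

text \<open>At level \<open>n\<close> the vertex lies in the tiles indexed by
  \<open>v <# F n\<close>. There are \<open>card (F n)\<close> of them, each of weight
  \<open>1 / card (F n)\<close>, so each level contributes at least 1.\<close>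

lemma emeasure_walls_around:
  assumes v: "v \<in> carrier G"
  shows "emeasure wall_measure (walls_around v) = \<infinity>"
proof -
  have "1 \<le> ennreal (1 / card (F n)) * emeasure (count_space UNIV) {g \<in> carrier G. tile_wall n g \<in> walls_around v}" for n
  proof -
    have "v <# F n \<subseteq> {g \<in> carrier G. tile_wall n g \<in> walls_around v}"
    proof
      fix g assume "g \<in> v <# F n"
      then obtain f where f: "f \<in> F n" "g = v \<otimes> f" by (auto simp: l_coset_def)
      then have "f \<in> carrier G" using F_subset by blast
      then have "inv v \<otimes> g = f" "g \<in> carrier G" using f v by (auto simp: m_assoc[symmetric])
      then have "g \<in> carrier G" "v \<in> tile n g" using f v by (auto simp: tile_def)
      then show "g \<in> {g \<in> carrier G. tile_wall n g \<in> walls_around v}" by (auto simp: walls_around_def)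
    qed
    then have "emeasure (count_space UNIV) (v <# F n)
        \<le> emeasure (count_space UNIV) {g \<in> carrier G. tile_wall n g \<in> walls_around v}"
      by (intro emeasure_mono) auto
    moreover have "emeasure (count_space UNIV) (v <# F n) = ennreal (card (F n))"
      using mult_card_l_coset[OF v F_subset] finite_F[of n]
      by (subst emeasure_count_space_finite) (auto simp: l_coset_def ennreal_of_nat_eq_real_of_nat)
    ultimately have "ennreal (1 / card (F n)) * ennreal (card (F n)) \<le>
        ennreal (1 / card (F n)) * emeasure (count_space UNIV) {g \<in> carrier G. tile_wall n g \<in> walls_around v}"
      by (intro mult_left_mono) auto
    moreover have "ennreal (1 / card (F n)) * ennreal (card (F n)) = 1"
      using card_F_pos[of n] by (simp add: ennreal_mult[symmetric])
    ultimately show ?thesis by simp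
  qed
  then have "(\<Sum>n. 1 :: ennreal) \<le> emeasure wall_measure (walls_around v)"
    unfolding emeasure_wall_measure[OF walls_around_subset] by (intro suminf_le summableI)
  moreover have "(\<Sum>n. 1 :: ennreal) = \<infinity>"
    using nn_integral_count_space_nat[of "\<lambda>_. 1"] by simp
  ultimately show ?thesis by (simp add: top_unique)
qed

section \<open>Invariance of the wall measure under translations\<close>

lemma translate_wall_measurable:
  assumes "h \<in> carrier G"
  shows "translate_wall h \<in> measurable wall_measure wall_measure"
proof -
  have "translate_wall h W \<in> tile_walls" if "W \<in> tile_walls" for W
  proof -
    obtain n g where "g \<in> carrier G" "W = tile_wall n g" using \<open>W \<in> tile_walls\<close> by (auto simp: tile_walls_def)
    then show ?thesis using assms by (auto simp: tile_walls_def translate_tile_wall)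
  qed
  then show ?thesis by (auto simp: measurable_def)
qed

text \<open>Translation by \<open>h\<close> acts on indices as left multiplication, a bijection
  within each level, and the weight depends only on the level.\<close>

lemma distr_translate_wall:
  assumes h: "h \<in> carrier G"
  shows "distr wall_measure wall_measure (translate_wall h) = wall_measure"
proof (rule measure_eqI)
  fix A assume "A \<in> sets (distr wall_measure wall_measure (translate_wall h))"
  then have A: "A \<subseteq> tile_walls" by simp
  have bij: "bij_betw (\<lambda>g. h \<otimes> g) {g \<in> carrier G. tile_wall n g \<in> translate_wall h -` A \<inter> tile_walls}
      {g \<in> carrier G. tile_wall n g \<in> A}" for n
  proof (rule bij_betwI[of _ _ _ "\<lambda>g. inv h \<otimes> g"])
    show "(\<lambda>g. h \<otimes> g) \<in> {g \<in> carrier G. tile_wall n g \<in> translate_wall h -` A \<inter> tile_walls} \<rightarrow> {g \<in> carrier G. tile_wall n g \<in> A}"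
      using h translate_tile_wall by (auto simp del: image_insert)
    show "(\<lambda>g. inv h \<otimes> g) \<in> {g \<in> carrier G. tile_wall n g \<in> A} \<rightarrow> {g \<in> carrier G. tile_wall n g \<in> translate_wall h -` A \<inter> tile_walls}"
    proof
      fix g assume g: "g \<in> {g \<in> carrier G. tile_wall n g \<in> A}"
      then have "translate_wall h (tile_wall n (inv h \<otimes> g)) = tile_wall n g"
        using h by (simp add: translate_tile_wall m_assoc[symmetric])
      then show "inv h \<otimes> g \<in> {g \<in> carrier G. tile_wall n g \<in> translate_wall h -` A \<inter> tile_walls}"
        using g h by (auto simp: tile_walls_def)
    qed
  qed (use h in \<open>auto simp: m_assoc[symmetric]\<close>)
  have "emeasure (distr wall_measure wall_measure (translate_wall h)) A =
      emeasure wall_measure (translate_wall h -` A \<inter> tile_walls)"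
    using A translate_wall_measurable[OF h] by (subst emeasure_distr) auto
  also have "\<dots> = emeasure wall_measure A"
    unfolding emeasure_wall_measure[OF A] emeasure_wall_measure[OF Int_lower2]
    by (simp only: emeasure_count_space_bij_betw[OF bij])
  finally show "emeasure (distr wall_measure wall_measure (translate_wall h)) A = emeasure wall_measure A" .
qed simp

lemma invariant_wall_action_translate:
  "invariant_wall_action G (carrier G) translate wall_measure"
  unfolding invariant_wall_action_def measured_walls_def
proof (intro conjI ballI impI)
  show "group_action G (carrier G) translate"
    unfolding translate_def by (rule group_action_left_mult) (rule group_axioms)
  show "wall (carrier G) W" if "W \<in> space wall_measure" for W
    using that wall_tile_wall by (auto simp: tile_walls_def)
qed (auto simp: walls_between_def emeasure_walls_between translate_wall_measurable distr_translate_wall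
  intro: emeasure_walls_between[unfolded walls_between_def, simplified])

text \<open>The orbit of the identity is the whole group, and both sides of every wall are nonempty;
  so restricting to the orbit walls changes nothing.\<close>

lemma orbit_walls_translate: "orbit_walls G translate wall_measure \<one> = space wall_measure"
proof
  show "space wall_measure \<subseteq> orbit_walls G translate wall_measure \<one>"
  proof
    fix W assume "W \<in> space wall_measure"
    then obtain n g where W: "W = tile_wall n g" "g \<in> carrier G" "W \<in> tile_walls" by (auto simp: tile_walls_def)
    obtain x y where xy: "x \<in> tile n g" "y \<in> carrier G - tile n g"
      using tile_nonempty tile_compl_nonempty W by blast
    then have "x \<in> carrier G" using tile_subset by blast
    then have "W \<in> walls_between wall_measure (translate x \<one>) (translate y \<one>)"
      using W xy by (simp add: walls_between_def separates_tile_wall)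
    then show "W \<in> orbit_walls G translate wall_measure \<one>"
      using \<open>x \<in> carrier G\<close> xy unfolding orbit_walls_def by blast
  qed
qed (auto simp: orbit_walls_def walls_between_def)

lemma countable_tile_walls: "countable tile_walls"
  using countable_carrier by (simp add: tile_walls_def)

end

section \<open>Auxiliary facts on cosets, Cayley edges and clusters\<close>

lemma restrict_space_space: "restrict_space M (space M) = M"
proof (rule measure_eqI)
  have "(\<inter>) (space M) ` sets M = (\<lambda>A. A) ` sets M"
    by (intro image_cong refl) (simp add: sets.Int_space_eq1)
  then show "sets (restrict_space M (space M)) = sets M"
    by (simp add: sets_restrict_space)
  then show "emeasure (restrict_space M (space M)) A = emeasure M A"
    if "A \<in> sets (restrict_space M (space M))" for A
    using that sets.sets_into_space by (intro emeasure_restrict_space) auto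
qed

lemma (in group) l_coset_eq_image: "g <# A = (\<lambda>x. g \<otimes> x) ` A"
  by (auto simp: l_coset_def)

lemma cayley_edgesE:
  fixes G (structure)
  assumes "group G" "S \<subseteq> carrier G" "e \<in> cayley_edges G S"
  obtains x y where "x \<in> carrier G" "y \<in> carrier G" "e = {x, y}"
proof -
  interpret group G by fact
  obtain g s where "e = {g, g \<otimes> s}" "g \<in> carrier G" "s \<in> S"
    using assms(3) by (auto simp: cayley_edges_def)
  then show ?thesis using assms(2) that[of g "g \<otimes> s"] by auto
qed

lemma (in group) l_coset_cayley_edges:
  assumes S: "S \<subseteq> carrier G" and h: "h \<in> carrier G" and e: "e \<in> cayley_edges G S"
  shows "h <# e \<in> cayley_edges G S"
proof -
  obtain g s where *: "e = {g, g \<otimes> s}" "g \<in> carrier G" "s \<in> S"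
    using e by (auto simp: cayley_edges_def)
  then have "h <# e = {h \<otimes> g, h \<otimes> g \<otimes> s}"
    using h S by (auto simp: l_coset_eq_image m_assoc)
  then show ?thesis using * h by (auto simp: cayley_edges_def)
qed

lemma (in group) l_coset_inv_cancel:
  assumes "h \<in> carrier G" "A \<subseteq> carrier G"
  shows "inv h <# (h <# A) = A" "h <# (inv h <# A) = A"
  using assms by (simp_all add: lcos_m_assoc lcos_mult_one)

lemma (in group) finite_edges_at:
  assumes "finite S" "S \<subseteq> carrier G" "v \<in> carrier G"
  shows "finite {e \<in> cayley_edges G S. v \<in> e}"
proof -
  have "{e \<in> cayley_edges G S. v \<in> e} \<subseteq>
      (\<lambda>s. {v, v \<otimes> s}) ` S \<union> (\<lambda>s. {v \<otimes> inv s, v}) ` S"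
  proof
    fix e assume "e \<in> {e \<in> cayley_edges G S. v \<in> e}"
    then obtain g s where e: "e = {g, g \<otimes> s}" "g \<in> carrier G" "s \<in> S" "v = g \<or> v = g \<otimes> s"
      unfolding cayley_edges_def by blast
    have "s \<in> carrier G" using e(3) assms(2) by blast
    from e(4) show "e \<in> (\<lambda>s. {v, v \<otimes> s}) ` S \<union> (\<lambda>s. {v \<otimes> inv s, v}) ` S"
    proof
      assume "v = g"
      then show ?thesis using e(1,3) by (intro UnI1 image_eqI) simp
    next
      assume v: "v = g \<otimes> s"
      then have "g = v \<otimes> inv s" using e(2) \<open>s \<in> carrier G\<close> by (simp add: m_assoc)
      then have "e = {v \<otimes> inv s, v}" using e(1) v by simp
      then show ?thesis using e(3) by (intro UnI2 image_eqI)
    qed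
  qed
  then show ?thesis by (rule finite_subset) (simp add: assms(1))
qed

lemma cluster_subset:
  assumes v: "v \<in> T" and closed: "\<And>x y. {x, y} \<in> \<omega> \<Longrightarrow> x \<in> T \<Longrightarrow> y \<in> T"
  shows "cluster \<omega> v \<subseteq> T"
proof
  fix w assume "w \<in> cluster \<omega> v"
  then have "(v, w) \<in> {(x, y). {x, y} \<in> \<omega>}\<^sup>*" by (simp add: cluster_def)
  then show "w \<in> T"
    by induction (use v closed in auto)
qed

section \<open>Walls crossing an edge\<close>

context folner_walls begin

text \<open>Defined from the edge as a set, so that no choice or order of endpoints enters. For a
  loop it is empty.\<close>

definition edge_walls :: "'a set \<Rightarrow> 'a set set set" where
  "edge_walls e = {W \<in> tile_walls. \<exists>x\<in>e. \<exists>y\<in>e. separates W x y}"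

lemma edge_walls_subset: "edge_walls e \<subseteq> tile_walls"
  by (auto simp: edge_walls_def)

lemma edge_walls_pair:
  assumes "x \<in> carrier G" "y \<in> carrier G"
  shows "edge_walls {x, y} = walls_between wall_measure x y"
proof -
  have "(\<exists>a\<in>{x, y}. \<exists>b\<in>{x, y}. separates W a b) \<longleftrightarrow> separates W x y" if "W \<in> tile_walls" for W
    using that assms by (auto simp: tile_walls_def separates_tile_wall)
  then show ?thesis by (auto simp: edge_walls_def walls_between_def)
qed

lemma tile_wall_in_edge_walls:
  assumes "g \<in> carrier G" "x \<in> carrier G" "y \<in> carrier G" "x \<in> tile n g" "y \<notin> tile n g"
  shows "tile_wall n g \<in> edge_walls {x, y}"
  using assms by (auto simp: edge_walls_pair walls_between_def separates_tile_wall tile_walls_def)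

lemma open_edges_eq:
  assumes S: "S \<subseteq> carrier G"
  shows "open_edges G S translate wall_measure \<one> N =
    {e \<in> cayley_edges G S. emeasure N (edge_walls e) = 0}"
proof (intro equalityI subsetI)
  fix e assume "e \<in> open_edges G S translate wall_measure \<one> N"
  then show "e \<in> {e \<in> cayley_edges G S. emeasure N (edge_walls e) = 0}"
    by (auto simp: open_edges_def edge_walls_pair)
next
  fix e assume e: "e \<in> {e \<in> cayley_edges G S. emeasure N (edge_walls e) = 0}"
  then obtain x y where "x \<in> carrier G" "y \<in> carrier G" "e = {x, y}"
    using cayley_edgesE[OF group_axioms S, of e] by auto
  then show "e \<in> open_edges G S translate wall_measure \<one> N"
    using e unfolding open_edges_def
    by (intro CollectI exI[of _ x] exI[of _ y]) (simp add: edge_walls_pair)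
qed

lemma emeasure_edge_walls:
  assumes "S \<subseteq> carrier G" "e \<in> cayley_edges G S"
  shows "emeasure wall_measure (edge_walls e) < \<infinity>"
proof -
  obtain x y where "x \<in> carrier G" "y \<in> carrier G" "e = {x, y}"
    using cayley_edgesE[OF group_axioms assms] .
  then show ?thesis using emeasure_walls_between by (simp add: edge_walls_pair)
qed

text \<open>Translating a wall and two points by the same \<open>h\<close> preserves separation, by
  \<open>tile_mult\<close>. The preimage form is the one that the invariance of
  \<open>wall_measure\<close> can be applied to.\<close>

lemma translate_wall_vimage_edge_walls:
  assumes h: "h \<in> carrier G" and e: "e \<subseteq> carrier G"
  shows "translate_wall h -` edge_walls (h <# e) \<inter> tile_walls = edge_walls e"
proof -
  have "translate_wall h W \<in> edge_walls (h <# e) \<longleftrightarrow> W \<in> edge_walls e" if W: "W \<in> tile_walls" for W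
  proof -
    obtain n g where g: "W = tile_wall n g" "g \<in> carrier G" using W by (auto simp: tile_walls_def)
    have "separates (tile_wall n (h \<otimes> g)) (h \<otimes> x) (h \<otimes> y) \<longleftrightarrow> separates (tile_wall n g) x y"
      if "x \<in> carrier G" "y \<in> carrier G" for x y
      using that g h by (simp add: separates_tile_wall tile_mult)
    then have "(\<exists>x\<in>e. \<exists>y\<in>e. separates (tile_wall n (h \<otimes> g)) (h \<otimes> x) (h \<otimes> y)) \<longleftrightarrow>
        (\<exists>x\<in>e. \<exists>y\<in>e. separates (tile_wall n g) x y)"
      using e by (meson subsetD)
    moreover have "tile_wall n (h \<otimes> g) \<in> tile_walls" using g h by (auto simp: tile_walls_def)
    ultimately show ?thesis
      using W by (simp add: g(1) translate_tile_wall[OF h g(2)] edge_walls_def l_coset_eq_image)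
  qed
  then show ?thesis using edge_walls_subset[of e] by blast
qed

lemma emeasure_UN_edge_walls_translate:
  assumes h: "h \<in> carrier G" and K: "\<And>e. e \<in> K \<Longrightarrow> e \<subseteq> carrier G"
  shows "emeasure wall_measure (\<Union>e\<in>K. edge_walls (h <# e)) = emeasure wall_measure (\<Union>e\<in>K. edge_walls e)"
proof -
  have "emeasure wall_measure (\<Union>e\<in>K. edge_walls (h <# e)) =
      emeasure (distr wall_measure wall_measure (translate_wall h)) (\<Union>e\<in>K. edge_walls (h <# e))"
    by (simp only: distr_translate_wall[OF h])
  also have "\<dots> = emeasure wall_measure (translate_wall h -` (\<Union>e\<in>K. edge_walls (h <# e)) \<inter> space wall_measure)"
    using edge_walls_subset by (intro emeasure_distr translate_wall_measurable[OF h]) auto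
  also have "translate_wall h -` (\<Union>e\<in>K. edge_walls (h <# e)) \<inter> space wall_measure =
      (\<Union>e\<in>K. translate_wall h -` edge_walls (h <# e) \<inter> tile_walls)"
    unfolding space_wall_measure by blast
  also have "\<dots> = (\<Union>e\<in>K. edge_walls e)"
    using translate_wall_vimage_edge_walls[OF h K] by simp
  finally show ?thesis .
qed

text \<open>An atom is finite because its wall separates some pair of points, and all walls
  separating that pair together have finite mass.\<close>

lemma discrete_intensity_wall_measure:
  "discrete_intensity (scale_measure (ennreal r) wall_measure)"
proof
  show "countable (space (scale_measure (ennreal r) wall_measure))"
    using countable_tile_walls by (simp add: space_scale_measure)
  show "sets (scale_measure (ennreal r) wall_measure) = Pow (space (scale_measure (ennreal r) wall_measure))"
    by (simp add: space_scale_measure)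
  fix W assume "W \<in> space (scale_measure (ennreal r) wall_measure)"
  then obtain n g where W: "W = tile_wall n g" "g \<in> carrier G" "W \<in> tile_walls"
    by (auto simp: tile_walls_def space_scale_measure)
  obtain x y where xy: "x \<in> tile n g" "y \<in> carrier G - tile n g"
    using tile_nonempty tile_compl_nonempty W by blast
  have x: "x \<in> carrier G" using xy tile_subset by blast
  then have "emeasure wall_measure {W} \<le> emeasure wall_measure (walls_between wall_measure x y)"
    using W xy by (intro emeasure_mono) (auto simp: walls_between_def separates_tile_wall)
  also have "\<dots> < \<infinity>" using x xy by (intro emeasure_walls_between) auto
  finally show "emeasure (scale_measure (ennreal r) wall_measure) {W} < \<infinity>"
    by (simp add: ennreal_mult_less_top)
qed

end

section \<open>The percolation\<close>

locale tile_percolation = folner_walls +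
  fixes S :: "'a set" and p :: real and M :: "'m measure" and \<eta> :: "'m \<Rightarrow> 'a set set measure"
  assumes S_subset: "S \<subseteq> carrier G" and countable_S: "countable S"
    and p: "p < 1"
    and ppp: "poisson_point_process M \<eta> (scale_measure (ennreal (1 - p)) wall_measure)"
begin

sublocale prob_space M using ppp by (rule ppp_prob_space)

abbreviation "E \<equiv> cayley_edges G S"

text \<open>By \<open>open_edges_eq\<close> these are the open edges of the Poisson wall
  construction with the identity as base point.\<close>

definition open_set :: "'m \<Rightarrow> 'a set set" where
  "open_set m = {e \<in> E. emeasure (\<eta> m) (edge_walls e) = 0}"

abbreviation law :: "'a set set measure" where
  "law \<equiv> distr M (edge_configs E) open_set"

lemma sets_\<eta> [simp]: "m \<in> space M \<Longrightarrow> sets (\<eta> m) = Pow tile_walls"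
  using ppp_sets[OF ppp] by simp

lemma \<eta>_measurable [measurable]: "A \<subseteq> tile_walls \<Longrightarrow> (\<lambda>m. emeasure (\<eta> m) A) \<in> borel_measurable M"
  by (rule ppp_measurable[OF ppp]) simp

lemma edge_subset:
  assumes "e \<in> E"
  shows "e \<subseteq> carrier G"
proof -
  obtain x y where "x \<in> carrier G" "y \<in> carrier G" "e = {x, y}"
    using cayley_edgesE[OF group_axioms S_subset assms] .
  then show ?thesis by simp
qed

lemma countable_E: "countable E"
proof -
  have "E = (\<Union>g\<in>carrier G. \<Union>s\<in>S. {{g, g \<otimes> s}})" unfolding cayley_edges_def by blast
  then show ?thesis using countable_carrier countable_S by simp
qed

lemma open_set_measurable: "open_set \<in> measurable M (edge_configs E)"
proof (rule measurable_edge_configsI)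
  fix e assume e: "e \<in> E"
  have [measurable]: "(\<lambda>m. emeasure (\<eta> m) (edge_walls e)) \<in> borel_measurable M"
    by (intro \<eta>_measurable edge_walls_subset)
  have "{m \<in> space M. emeasure (\<eta> m) (edge_walls e) = 0} \<in> sets M" by measurable
  then show "{m \<in> space M. e \<in> open_set m} \<in> sets M" using e by (simp add: open_set_def)
qed (auto simp: open_set_def)

lemma prob_space_law: "prob_space law"
  using open_set_measurable by (rule prob_space_distr)

text \<open>Openness of several edges becomes emptiness of one set of walls, so its probability is a
  single void probability even though edges may share walls.\<close>

lemma subset_open_set_iff:
  assumes "m \<in> space M" "finite K" "K \<subseteq> E"
  shows "K \<subseteq> open_set m \<longleftrightarrow> emeasure (\<eta> m) (\<Union>e\<in>K. edge_walls e) = 0"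
proof -
  have sets: "edge_walls e \<in> sets (\<eta> m)" for e
    using edge_walls_subset by (simp add: assms(1))
  have UN_sets: "(\<Union>e\<in>K. edge_walls e) \<in> sets (\<eta> m)"
    using sets assms(2) by (intro sets.finite_UN)
  show ?thesis
  proof
    assume "K \<subseteq> open_set m"
    then have "emeasure (\<eta> m) (edge_walls e) = 0" if "e \<in> K" for e
      using that by (auto simp: open_set_def)
    then have "(\<Sum>e\<in>K. emeasure (\<eta> m) (edge_walls e)) = 0" by simp
    moreover have "emeasure (\<eta> m) (\<Union>e\<in>K. edge_walls e) \<le> (\<Sum>e\<in>K. emeasure (\<eta> m) (edge_walls e))"
      using sets by (intro emeasure_subadditive_finite[OF assms(2)]) blast
    ultimately show "emeasure (\<eta> m) (\<Union>e\<in>K. edge_walls e) = 0" by simp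
  next
    assume 0: "emeasure (\<eta> m) (\<Union>e\<in>K. edge_walls e) = 0"
    show "K \<subseteq> open_set m"
    proof
      fix e assume e: "e \<in> K"
      then have "emeasure (\<eta> m) (edge_walls e) = 0"
        by (intro emeasure_eq_0[OF UN_sets 0] UN_upper)
      then show "e \<in> open_set m" using e assms(3) by (auto simp: open_set_def)
    qed
  qed
qed

lemma emeasure_law_superset:
  assumes K: "finite K" "K \<subseteq> E"
  shows "emeasure law {\<omega> \<in> Pow E. K \<subseteq> \<omega>} =
    ennreal (exp (- ((1 - p) * measure wall_measure (\<Union>e\<in>K. edge_walls e))))"
proof -
  let ?A = "\<Union>e\<in>K. edge_walls e"
  have A: "?A \<subseteq> tile_walls" using edge_walls_subset by auto
  have "{\<omega> \<in> Pow E. K \<subseteq> \<omega>} = {\<omega> \<in> space (edge_configs E). \<forall>e\<in>K. e \<in> \<omega>}" by auto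
  also have "\<dots> \<in> sets (edge_configs E)"
    using K edge_open_sets[of _ E] by (intro sets.sets_Collect_finite_All) (simp_all add: subset_iff)
  finally have "emeasure law {\<omega> \<in> Pow E. K \<subseteq> \<omega>} = emeasure M (open_set -` {\<omega> \<in> Pow E. K \<subseteq> \<omega>} \<inter> space M)"
    by (rule emeasure_distr[OF open_set_measurable])
  also have "open_set -` {\<omega> \<in> Pow E. K \<subseteq> \<omega>} \<inter> space M = {m \<in> space M. emeasure (\<eta> m) ?A = of_nat 0}"
    using subset_open_set_iff[OF _ K] by (auto simp: open_set_def)
  also have "emeasure M \<dots> = ennreal (exp (- measure (scale_measure (ennreal (1 - p)) wall_measure) ?A))"
  proof -
    have "emeasure wall_measure ?A \<le> (\<Sum>e\<in>K. emeasure wall_measure (edge_walls e))"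
      using K edge_walls_subset by (intro emeasure_subadditive_finite) auto
    also have "\<dots> < \<infinity>"
      using K emeasure_edge_walls[OF S_subset] by (auto simp: less_top[symmetric])
    finally have "emeasure (scale_measure (ennreal (1 - p)) wall_measure) ?A < \<infinity>"
      by (simp add: ennreal_mult_less_top)
    then show ?thesis
      using ppp_prob[OF ppp, of ?A 0] A by (simp add: emeasure_eq_measure)
  qed
  also have "measure (scale_measure (ennreal (1 - p)) wall_measure) ?A = (1 - p) * measure wall_measure ?A"
    using p by (simp add: measure_def enn2real_mult)
  finally show ?thesis .
qed

text \<open>It suffices to compare the events that a finite \<open>K\<close> is open. Translation
  turns such an event into the one for the edges moved by \<open>inv h\<close>, whose crossing walls
  have the same total mass.\<close>

lemma law_invariant:
  assumes h: "h \<in> carrier G"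
  shows "distr law (edge_configs E) (\<lambda>\<omega>. (\<lambda>e. h <# e) ` \<omega>) = law"
proof -
  let ?T = "\<lambda>\<omega>. (\<lambda>e. h <# e) ` \<omega>"
  have ih: "inv h \<in> carrier G" using h by simp
  have mem: "e \<in> ?T \<omega> \<longleftrightarrow> inv h <# e \<in> \<omega>" if "e \<in> E" "\<omega> \<subseteq> E" for e \<omega>
  proof
    assume "e \<in> ?T \<omega>"
    then obtain d where "d \<in> \<omega>" "e = h <# d" by blast
    then show "inv h <# e \<in> \<omega>" using l_coset_inv_cancel(1)[OF h edge_subset] that by auto
  next
    assume "inv h <# e \<in> \<omega>"
    then show "e \<in> ?T \<omega>" using l_coset_inv_cancel(2)[OF h edge_subset[OF that(1)]] by (intro image_eqI) auto
  qed
  have TE: "?T \<omega> \<subseteq> E" if "\<omega> \<subseteq> E" for \<omega>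
    using that by (intro image_subsetI l_coset_cayley_edges[OF S_subset h]) blast
  have T: "?T \<in> measurable (edge_configs E) (edge_configs E)"
  proof (rule measurable_edge_configsI)
    show "?T \<omega> \<subseteq> E" if "\<omega> \<in> space (edge_configs E)" for \<omega> using that TE by simp
    fix e assume e: "e \<in> E"
    have "{\<omega> \<in> space (edge_configs E). e \<in> ?T \<omega>} = {\<omega> \<in> Pow E. inv h <# e \<in> \<omega>}"
      using mem[OF e] by auto
    then show "{\<omega> \<in> space (edge_configs E). e \<in> ?T \<omega>} \<in> sets (edge_configs E)"
      using edge_open_sets[OF l_coset_cayley_edges[OF S_subset ih e]] by simp
  qed
  have T': "?T \<in> measurable law (edge_configs E)" using T by simp
  have "law = distr law (edge_configs E) ?T"
  proof (rule edge_configs_measure_eqI[OF prob_space_law])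
    fix K assume K: "finite K" "K \<subseteq> E"
    let ?L = "(\<lambda>e. inv h <# e) ` K"
    have L: "finite ?L" "?L \<subseteq> E" using K l_coset_cayley_edges[OF S_subset ih] by auto
    have "{\<omega> \<in> Pow E. K \<subseteq> \<omega>} = {\<omega> \<in> space (edge_configs E). \<forall>e\<in>K. e \<in> \<omega>}" by auto
    also have "\<dots> \<in> sets (edge_configs E)"
      using K edge_open_sets[of _ E] by (intro sets.sets_Collect_finite_All) (simp_all add: subset_iff)
    finally have "emeasure (distr law (edge_configs E) ?T) {\<omega> \<in> Pow E. K \<subseteq> \<omega>} =
        emeasure law (?T -` {\<omega> \<in> Pow E. K \<subseteq> \<omega>} \<inter> space law)"
      by (rule emeasure_distr[OF T'])
    also have "?T -` {\<omega> \<in> Pow E. K \<subseteq> \<omega>} \<inter> space law = {\<omega> \<in> Pow E. ?L \<subseteq> \<omega>}"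
    proof -
      have "K \<subseteq> ?T \<omega> \<longleftrightarrow> ?L \<subseteq> \<omega>" if "\<omega> \<subseteq> E" for \<omega>
        unfolding image_subset_iff subset_eq[of K]
        by (intro ball_cong refl mem[OF _ that]) (use K in blast)
      then have iff: "\<omega> \<in> ?T -` {\<omega> \<in> Pow E. K \<subseteq> \<omega>} \<inter> space law \<longleftrightarrow> \<omega> \<in> {\<omega> \<in> Pow E. ?L \<subseteq> \<omega>}" for \<omega>
        using TE[of \<omega>] by (cases "\<omega> \<subseteq> E") simp_all
      show ?thesis by (rule Set.set_eqI) (rule iff)
    qed
    also have "emeasure law {\<omega> \<in> Pow E. ?L \<subseteq> \<omega>} = emeasure law {\<omega> \<in> Pow E. K \<subseteq> \<omega>}"
    proof -
      have "emeasure wall_measure (\<Union>e\<in>?L. edge_walls e) = emeasure wall_measure (\<Union>e\<in>K. edge_walls e)"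
        using emeasure_UN_edge_walls_translate[OF ih, of K] K edge_subset by auto
      then show ?thesis
        by (simp only: emeasure_law_superset[OF K] emeasure_law_superset[OF L] measure_def)
    qed
    finally show "emeasure law {\<omega> \<in> Pow E. K \<subseteq> \<omega>} =
        emeasure (distr law (edge_configs E) ?T) {\<omega> \<in> Pow E. K \<subseteq> \<omega>}" by simp
  qed simp_all
  then show ?thesis by simp
qed

lemma invariant_percolation_law: "invariant_percolation G E law"
  unfolding invariant_percolation_def using prob_space_law law_invariant by simp

text \<open>The walls around \<open>v\<close> have infinite intensity, so almost surely one of them
  carries a point of the process, and every edge crossing its tile is closed.\<close>

lemma AE_trapped:
  assumes v: "v \<in> carrier G"
  shows "AE \<omega> in law. \<exists>n. \<exists>g\<in>carrier G. v \<in> tile n g \<and>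
    (\<forall>e\<in>E. e \<inter> tile n g \<noteq> {} \<and> e - tile n g \<noteq> {} \<longrightarrow> e \<notin> \<omega>)"
    (is "AE \<omega> in law. ?Q \<omega>")
proof -
  \<comment> \<open>Only countable quantifiers over edge events occur, so the event is measurable
    and may be transferred between \<open>M\<close> and the law. Finiteness of clusters is deduced
    from it pointwise later.\<close>
  have "{\<omega> \<in> space (edge_configs E). ?Q \<omega>} \<in> sets (edge_configs E)"
  proof -
    have *: "{\<omega> \<in> space (edge_configs E). e \<notin> \<omega>} \<in> sets (edge_configs E)" if "e \<in> E" for e
      using edge_open_sets[OF that] by (intro sets.sets_Collect_neg) simp
    show ?thesis
      by (intro sets.sets_Collect_const sets.sets_Collect_countable_Ex
        sets.sets_Collect_countable_Ex'[OF _ countable_carrier] sets.sets_Collect_conj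
        sets.sets_Collect_countable_All'[OF _ countable_E] sets.sets_Collect_imp *)
  qed
  moreover have "AE m in M. ?Q (open_set m)"
  proof -
    have "emeasure (scale_measure (ennreal (1 - p)) wall_measure) (walls_around v) = \<infinity>"
      using emeasure_walls_around[OF v] p by (simp add: ennreal_mult_top)
    then have "AE m in M. emeasure (\<eta> m) (walls_around v) = \<infinity>"
      using walls_around_subset by (intro ppp_AE_infinite[OF ppp]) auto
    then show ?thesis
      using AE_space
    proof eventually_elim
      case (elim m)
      \<comment> \<open>Otherwise \<open>walls_around v\<close> would be a countable union of null
        atoms, against its infinite mass.\<close>
      have "\<exists>W\<in>walls_around v. emeasure (\<eta> m) {W} \<noteq> 0"
      proof (rule ccontr)
        assume "\<not> (\<exists>W\<in>walls_around v. emeasure (\<eta> m) {W} \<noteq> 0)"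
        then have "{W} \<in> null_sets (\<eta> m)" if "W \<in> walls_around v" for W
          using that elim walls_around_subset by (auto simp: null_sets_def)
        moreover have "countable (walls_around v)"
          using walls_around_subset countable_tile_walls by (rule countable_subset)
        ultimately have "(\<Union>W\<in>walls_around v. {W}) \<in> null_sets (\<eta> m)"
          by (intro null_sets_UN')
        then show False using elim by (simp add: null_sets_def)
      qed
      then obtain n g where W: "g \<in> carrier G" "v \<in> tile n g" "emeasure (\<eta> m) {tile_wall n g} \<noteq> 0"
        by (auto simp: walls_around_def)
      have "e \<notin> open_set m" if e: "e \<in> E" "e \<inter> tile n g \<noteq> {}" "e - tile n g \<noteq> {}" for e
      proof -
        obtain a b where ab: "a \<in> carrier G" "b \<in> carrier G" "e = {a, b}"
          using cayley_edgesE[OF group_axioms S_subset e(1)] .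
        then have "a \<in> tile n g \<and> b \<notin> tile n g \<or> b \<in> tile n g \<and> a \<notin> tile n g"
          using e(2,3) by auto
        then obtain x y where "x \<in> carrier G" "y \<in> carrier G" "e = {x, y}" "x \<in> tile n g" "y \<notin> tile n g"
          using ab by (metis insert_commute)
        then have "{tile_wall n g} \<subseteq> edge_walls e" using tile_wall_in_edge_walls W by auto
        then have "emeasure (\<eta> m) {tile_wall n g} \<le> emeasure (\<eta> m) (edge_walls e)"
          using elim edge_walls_subset by (intro emeasure_mono) auto
        then show ?thesis using W by (auto simp: open_set_def)
      qed
      then show ?case using W by blast
    qed
  qed
  ultimately show ?thesis
    using AE_distr_iff[OF open_set_measurable] by simp
qed

text \<open>A path of open edges starting at \<open>v\<close> cannot leave the finite tile that
  encloses \<open>v\<close>.\<close>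

lemma AE_finite_clusters: "AE \<omega> in law. \<forall>v\<in>carrier G. finite (cluster \<omega> v)"
proof -
  have "AE \<omega> in law. finite (cluster \<omega> v)" if v: "v \<in> carrier G" for v
    using AE_trapped[OF v] AE_space
  proof eventually_elim
    case (elim \<omega>)
    then obtain n g where g: "g \<in> carrier G" "v \<in> tile n g"
      and cut: "\<And>e. e \<in> E \<Longrightarrow> e \<inter> tile n g \<noteq> {} \<Longrightarrow> e - tile n g \<noteq> {} \<Longrightarrow> e \<notin> \<omega>" by blast
    have "cluster \<omega> v \<subseteq> tile n g"
    proof (rule cluster_subset[OF g(2)], rule ccontr)
      fix x y assume xy: "{x, y} \<in> \<omega>" "x \<in> tile n g" "y \<notin> tile n g"
      then have "{x, y} \<in> E" using elim by auto
      then show False using cut[of "{x, y}"] xy by auto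
    qed
    then show ?case using finite_tile[OF g(1)] finite_subset by blast
  qed
  then show ?thesis by (simp add: AE_ball_countable countable_carrier)
qed

text \<open>The degree is the sum of the indicators of the finitely many edges at \<open>v\<close>;
  each expectation is the void probability of the walls crossing that edge.\<close>

lemma expected_degree:
  assumes "finite S" "v \<in> carrier G"
  shows "(\<integral>\<omega>. real (degree_in \<omega> v) \<partial>law) =
    (\<Sum>e | e \<in> E \<and> v \<in> e. exp (- ((1 - p) * measure wall_measure (edge_walls e))))"
proof -
  interpret law: prob_space law by (rule prob_space_law)
  let ?N = "{e \<in> E. v \<in> e}"
  have fin: "finite ?N" by (rule finite_edges_at[OF assms(1) S_subset assms(2)])
  have "real (degree_in \<omega> v) = (\<Sum>e\<in>?N. indicat_real {\<omega> \<in> Pow E. {e} \<subseteq> \<omega>} \<omega>)" if "\<omega> \<in> space law" for \<omega>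
  proof -
    have "{e \<in> \<omega>. v \<in> e} = {e \<in> ?N. e \<in> \<omega>}" using that by auto
    then have "real (degree_in \<omega> v) = (\<Sum>e\<in>?N. if e \<in> \<omega> then 1 else 0)"
      using fin by (simp add: degree_in_def sum.If_cases Int_def)
    also have "\<dots> = (\<Sum>e\<in>?N. indicat_real {\<omega> \<in> Pow E. {e} \<subseteq> \<omega>} \<omega>)"
      using that by (intro sum.cong) (auto simp: indicator_def)
    finally show ?thesis .
  qed
  then have "(\<integral>\<omega>. real (degree_in \<omega> v) \<partial>law) = (\<integral>\<omega>. (\<Sum>e\<in>?N. indicat_real {\<omega> \<in> Pow E. {e} \<subseteq> \<omega>} \<omega>) \<partial>law)"
    by (intro Bochner_Integration.integral_cong) auto
  also have "\<dots> = (\<Sum>e\<in>?N. \<integral>\<omega>. indicat_real {\<omega> \<in> Pow E. {e} \<subseteq> \<omega>} \<omega> \<partial>law)"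
    using edge_open_sets[of _ E]
    by (intro Bochner_Integration.integral_sum integrable_real_indicator) (auto simp: law.emeasure_eq_measure)
  also have "\<dots> = (\<Sum>e\<in>?N. exp (- ((1 - p) * measure wall_measure (edge_walls e))))"
  proof (rule sum.cong[OF refl])
    fix e assume e: "e \<in> ?N"
    have "(\<integral>\<omega>. indicat_real {\<omega> \<in> Pow E. {e} \<subseteq> \<omega>} \<omega> \<partial>law) = measure law ({\<omega> \<in> Pow E. {e} \<subseteq> \<omega>} \<inter> space law)"
      by simp
    also have "{\<omega> \<in> Pow E. {e} \<subseteq> \<omega>} \<inter> space law = {\<omega> \<in> Pow E. {e} \<subseteq> \<omega>}"
      by auto
    also have "measure law \<dots> = exp (- ((1 - p) * measure wall_measure (edge_walls e)))"
      using emeasure_law_superset[of "{e}"] e by (simp add: measure_def)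
    finally show "(\<integral>\<omega>. indicat_real {\<omega> \<in> Pow E. {e} \<subseteq> \<omega>} \<omega> \<partial>law) =
      exp (- ((1 - p) * measure wall_measure (edge_walls e)))" .
  qed
  finally show ?thesis by simp
qed

end

theorem proposition1p5:
  fixes G :: "('a, 'b) monoid_scheme" and S :: "'a set"
  assumes "group G" and "infinite (carrier G)" and "amenable G"
    and "finite S" and "symmetric_generating_set G S"
  shows "\<exists>(X :: 'a set) \<phi> \<mu> x\<^sub>0.
    invariant_wall_action G X \<phi> \<mu> \<and> x\<^sub>0 \<in> X \<and>
    (\<forall>\<alpha>::real. \<alpha> < 1 \<longrightarrow> (\<exists>p::real. 0 < p \<and> p < 1 \<and>
      (\<exists>P. poisson_wall_percolation G S \<phi> \<mu> x\<^sub>0 p P \<and>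
           invariant_percolation G (cayley_edges G S) P \<and>
           (\<integral>\<omega>. real (degree_in \<omega> \<one>\<^bsub>G\<^esub>) \<partial>P) > \<alpha> * real (degree_in (cayley_edges G S) \<one>\<^bsub>G\<^esub>) \<and>
           (AE \<omega> in P. \<forall>v\<in>carrier G. finite (cluster \<omega> v)))))"
proof -
  interpret group G by fact
  have S: "S \<subseteq> carrier G" "generate G S = carrier G"
    using assms(5) by (simp_all add: symmetric_generating_set_def)
  have cnt: "countable (carrier G)"
    using countable_generate[of S] S assms(4) by (simp add: countable_finite)
  obtain F :: "nat \<Rightarrow> 'a set" where F: "(\<forall>n. finite (F n) \<and> F n \<noteq> {} \<and> F n \<subseteq> carrier G) \<and>
      (\<forall>g\<in>carrier G. \<exists>C. \<forall>n. real (card ((g <#\<^bsub>G\<^esub> F n) - F n)) \<le> C * (1 / 2) ^ n * card (F n))"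
    using amenable_folner_sequence[OF assms(3) cnt] by (rule exE)
  interpret folner_walls G F
    using assms(2) cnt F by unfold_locales blast+
  let ?N = "{e \<in> cayley_edges G S. \<one>\<^bsub>G\<^esub> \<in> e}"
  let ?w = "\<lambda>e. measure wall_measure (edge_walls e)"
  have finN: "finite ?N" by (rule finite_edges_at[OF assms(4) S(1) one_closed])
  \<comment> \<open>An infinite group is not generated by the empty set. Hence the identity has
    positive degree, and the final comparison of sums is strict.\<close>
  have "S \<noteq> {}"
  proof
    assume "S = {}"
    then have "finite (generate G S)" by (simp add: generate_empty)
    then show False using assms(2) S(2) by simp
  qed
  then obtain s where s: "s \<in> S" by blast
  define e\<^sub>0 where "e\<^sub>0 = {\<one>\<^bsub>G\<^esub>, \<one>\<^bsub>G\<^esub> \<otimes>\<^bsub>G\<^esub> s}"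
  have "e\<^sub>0 \<in> cayley_edges G S"
    unfolding cayley_edges_def e\<^sub>0_def using s one_closed by blast
  then have e\<^sub>0: "e\<^sub>0 \<in> ?N" by (simp add: e\<^sub>0_def)
  then have posN: "0 < card ?N" using finN card_gt_0_iff by blast
  \<comment> \<open>A common bound for the wall mass of the edges at the identity, so that each of
    them is open with probability at least \<open>exp (- (\<delta> * C))\<close>.\<close>
  define C where "C = Max (?w ` ?N)"
  have C: "?w e \<le> C" if "e \<in> ?N" for e
    unfolding C_def using that finN by (intro Max_ge) auto
  have C0: "0 \<le> C" using measure_nonneg C[OF e\<^sub>0] by (rule order_trans)
  show ?thesis
  proof (intro exI[of _ "carrier G"] exI[of _ translate] exI[of _ wall_measure] exI[of _ "\<one>\<^bsub>G\<^esub>"] conjI allI impI)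
    show "invariant_wall_action G (carrier G) translate wall_measure"
      by (rule invariant_wall_action_translate)
    show "\<one>\<^bsub>G\<^esub> \<in> carrier G" by simp
    fix \<alpha> :: real assume \<alpha>: "\<alpha> < 1"
    \<comment> \<open>\<open>\<delta>\<close> will be \<open>1 - p\<close>. The bound 1/2 keeps
      \<open>p\<close> inside the unit interval, the other one gives
      \<open>\<delta> * C < 1 - \<alpha>\<close>; \<open>C + 1\<close> replaces \<open>C\<close> to
      avoid dividing by 0.\<close>
    define \<delta> where "\<delta> = min (1 / 2) ((1 - \<alpha>) / (2 * (C + 1)))"
    have \<delta>: "0 < \<delta>" "\<delta> < 1" using \<alpha> C0 by (auto simp: \<delta>_def)
    have "\<delta> * C \<le> (1 - \<alpha>) / (2 * (C + 1)) * (C + 1)"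
      using \<alpha> C0 by (intro mult_mono) (auto simp: \<delta>_def)
    also have "\<dots> = (1 - \<alpha>) / 2" using C0 by (simp add: field_simps)
    also have "\<dots> < 1 - \<alpha>" using \<alpha> by simp
    finally have "\<alpha> < 1 + - (\<delta> * C)" by simp
    also have "\<dots> \<le> exp (- (\<delta> * C))" by (rule exp_ge_add_one_self)
    finally have \<alpha>_less: "\<alpha> < exp (- (\<delta> * C))" .
    define p where "p = 1 - \<delta>"
    have p_bounds: "0 < p" "p < 1" "1 - p = \<delta>" using \<delta> by (auto simp: p_def)
    let ?\<Lambda> = "scale_measure (ennreal (1 - p)) wall_measure"
    interpret \<Lambda>: discrete_intensity ?\<Lambda> by (rule discrete_intensity_wall_measure)
    obtain M :: "'a set set measure measure" and \<eta> where ppp: "poisson_point_process M \<eta> ?\<Lambda>"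
      using \<Lambda>.poisson_point_process_canonical by (elim exE)
    interpret tile_percolation G F S p M \<eta>
      using S(1) p_bounds(2) ppp countable_finite[OF assms(4)] by unfold_locales
    show "\<exists>p. 0 < p \<and> p < 1 \<and> (\<exists>P. poisson_wall_percolation G S translate wall_measure \<one>\<^bsub>G\<^esub> p P \<and>
        invariant_percolation G (cayley_edges G S) P \<and>
        \<alpha> * real (degree_in (cayley_edges G S) \<one>\<^bsub>G\<^esub>) < (\<integral>\<omega>. real (degree_in \<omega> \<one>\<^bsub>G\<^esub>) \<partial>P) \<and>
        (AE \<omega> in P. \<forall>v\<in>carrier G. finite (cluster \<omega> v)))"
    proof (intro exI[of _ p] exI[of _ law] conjI)
      show "poisson_wall_percolation G S translate wall_measure \<one>\<^bsub>G\<^esub> p law"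
        unfolding poisson_wall_percolation_def orbit_walls_translate restrict_space_space
        using ppp by (intro exI[of _ M] exI[of _ \<eta>] conjI) (simp_all add: open_edges_eq[OF S(1)] open_set_def[abs_def])
      show "invariant_percolation G (cayley_edges G S) law" by (rule invariant_percolation_law)
      show "AE \<omega> in law. \<forall>v\<in>carrier G. finite (cluster \<omega> v)" by (rule AE_finite_clusters)
      have "\<alpha> * real (degree_in (cayley_edges G S) \<one>\<^bsub>G\<^esub>) < (\<Sum>e\<in>?N. exp (- (\<delta> * C)))"
        using \<alpha>_less posN by (simp add: degree_in_def)
      also have "\<dots> \<le> (\<Sum>e\<in>?N. exp (- ((1 - p) * ?w e)))"
        using C \<delta> by (intro sum_mono) (simp add: p_bounds(3))
      also have "\<dots> = (\<integral>\<omega>. real (degree_in \<omega> \<one>\<^bsub>G\<^esub>) \<partial>law)"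
        using expected_degree[of "\<one>\<^bsub>G\<^esub>"] assms(4) by simp
      finally show "\<alpha> * real (degree_in (cayley_edges G S) \<one>\<^bsub>G\<^esub>) < (\<integral>\<omega>. real (degree_in \<omega> \<one>\<^bsub>G\<^esub>) \<partial>law)" .
    qed (fact p_bounds)+
  qed
qed

end
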